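(* Let $G$ be an abelian, second countable, locally compact group with Haar measure $\mu$, let $(\Lambda_n)$ be a F\o lner sequence in $G$, and let $K\subset G$ be a Borel set which is a semigroup (under the group operation) with $\Lambda_n\subset K$ for every $n$. Let $\Sigma$ denote the $\sigma$-algebra of Borel subsets of $G$ contained in $K$. Let $(A,\omega,\tau,K)$ be a compact C*-system with $\omega$ a trace. Let $a\in A^+$ with $\omega(a)>0$ and take any $m_0,\dots,m_k\in\mathbb{N}\cup\{0\}$. Assume that $g\mapsto\omega\left(\prod_{j=0}^k\tau_{g^{m_j}}(a)\right)$ and $g\mapsto\|\tau_{g^{m_j}}(a)-a\|_\omega$ ($j=0,1,\dots,k$) are $\Sigma$-measurable on $K$. Then there exists a F\o lner sequence $(\Lambda'_n)$ in $G$ with $\Lambda'_n\subset K$ for all $n$ such that \[ \liminf_{n\to\infty}\frac{1}{\mu(\Lambda'_n)}\int_{\Lambda'_n}\left|\omega\left(\prod_{j=0}^k\tau_{g^{m_j}}(a)\right)\right|d\mu(g)>0. \]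
   Context: A F\o lner sequence in $G$ is a sequence $(\Lambda_n)$ of compact subsets with $\mu(\Lambda_n)>0$ and $\lim_n\mu(\Lambda_n\,\Delta\,(\Lambda_n g))/\mu(\Lambda_n)=0$ for all $g\in G$. For a positive linear functional $\omega$ on a $*$-algebra $A$, $\|a\|_\omega:=\omega(a^*a)^{1/2}$ (a seminorm). A compact C*-system $(A,\omega,\tau,K)$ consists of a C*-algebra $A$, a positive linear functional $\omega$ on $A$, a semigroup $K$, and linear maps $\tau_g:A\to A$ ($g\in K$) with $\tau_g\circ\tau_h=\tau_{gh}$, $\|\tau_g(a)\|_\omega=\|a\|_\omega$ and $\|\tau_g(a)\|\le\|a\|$ for all $g,h\in K$, $a\in A$, such that each orbit $\{\tau_g(a):g\in K\}$ is totally bounded with respect to the seminorm $\|\cdot\|_\omega$. A trace is a state $\omega$ with $\omega(ab)=\omega(ba)$ for all $a,b$. $A^+$ is the set of positive elements of $A$. The convention $\tau_{g^0}(a):=a$ is used, and $\prod_{j=0}^k b_j=b_0b_1\cdots b_k$ in this order. *)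

theory Defs
  imports "HOL-Analysis.Analysis"
begin

text \<open>The abelian group G is written additively; g^m becomes m-fold sum.\<close>

definition gpow :: "nat \<Rightarrow> 'g::ab_group_add \<Rightarrow> 'g" where
  "gpow m g = (((+) g) ^^ m) 0"

definition lcsc_abelian_group :: "'g::{topological_ab_group_add, second_countable_topology, t2_space} itself \<Rightarrow> bool" where
  "lcsc_abelian_group _ \<longleftrightarrow> locally_compact_space (euclidean :: 'g topology)"

definition haar_measure :: "'g::{topological_ab_group_add, t2_space} measure \<Rightarrow> bool" where
  "haar_measure M \<longleftrightarrow>
     sets M = sets borel \<and>
     (\<forall>A g. A \<in> sets borel \<longrightarrow> emeasure M ((\<lambda>x. x + g) ` A) = emeasure M A) \<and>
     (\<forall>C. compact C \<longrightarrow> emeasure M C < \<infinity>) \<and>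
     (\<forall>U. open U \<and> U \<noteq> {} \<longrightarrow> emeasure M U > 0)"

definition folner :: "'g::{topological_ab_group_add, t2_space} measure \<Rightarrow> (nat \<Rightarrow> 'g set) \<Rightarrow> bool" where
  "folner M L \<longleftrightarrow>
     (\<forall>n. compact (L n) \<and> measure M (L n) > 0) \<and>
     (\<forall>g. (\<lambda>n. measure M ((L n - (\<lambda>x. x + g) ` L n) \<union> ((\<lambda>x. x + g) ` L n - L n))
                / measure M (L n)) \<longlonglongrightarrow> 0)"

definition semigroup_set :: "'g::plus set \<Rightarrow> bool" where
  "semigroup_set K \<longleftrightarrow> (\<forall>x\<in>K. \<forall>y\<in>K. x + y \<in> K)"

definition cstar_algebra :: "(complex \<Rightarrow> 'a::{real_normed_algebra, banach} \<Rightarrow> 'a) \<Rightarrow> ('a \<Rightarrow> 'a) \<Rightarrow> bool" where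
  "cstar_algebra sc st \<longleftrightarrow>
     (\<forall>r a. sc (complex_of_real r) a = r *\<^sub>R a) \<and>
     (\<forall>c d a. sc (c * d) a = sc c (sc d a)) \<and>
     (\<forall>c d a. sc (c + d) a = sc c a + sc d a) \<and>
     (\<forall>c a b. sc c (a + b) = sc c a + sc c b) \<and>
     (\<forall>c a b. sc c (a * b) = sc c a * b \<and> sc c (a * b) = a * sc c b) \<and>
     (\<forall>c a. norm (sc c a) = cmod c * norm a) \<and>
     (\<forall>a. st (st a) = a) \<and>
     (\<forall>a b. st (a + b) = st a + st b) \<and>
     (\<forall>c a. st (sc c a) = sc (cnj c) (st a)) \<and>
     (\<forall>a b. st (a * b) = st b * st a) \<and>
     (\<forall>a. norm (st a * a) = (norm a)\<^sup>2)"

definition clinear_on :: "(complex \<Rightarrow> 'a \<Rightarrow> 'a) \<Rightarrow> ('a::plus \<Rightarrow> 'a) \<Rightarrow> bool" where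
  "clinear_on sc f \<longleftrightarrow> (\<forall>a b. f (a + b) = f a + f b) \<and> (\<forall>c a. f (sc c a) = sc c (f a))"

definition positive_functional :: "(complex \<Rightarrow> 'a \<Rightarrow> 'a) \<Rightarrow> ('a \<Rightarrow> 'a) \<Rightarrow> ('a::{real_normed_algebra} \<Rightarrow> complex) \<Rightarrow> bool" where
  "positive_functional sc st \<omega> \<longleftrightarrow>
     (\<forall>a b. \<omega> (a + b) = \<omega> a + \<omega> b) \<and> (\<forall>c a. \<omega> (sc c a) = c * \<omega> a) \<and>
     (\<forall>a. Im (\<omega> (st a * a)) = 0 \<and> Re (\<omega> (st a * a)) \<ge> 0)"

definition is_state :: "(complex \<Rightarrow> 'a \<Rightarrow> 'a) \<Rightarrow> ('a \<Rightarrow> 'a) \<Rightarrow> ('a::{real_normed_algebra} \<Rightarrow> complex) \<Rightarrow> bool" where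
  "is_state sc st \<omega> \<longleftrightarrow> positive_functional sc st \<omega> \<and>
     Sup {cmod (\<omega> a) | a. norm a \<le> 1} = 1"

definition is_trace :: "(complex \<Rightarrow> 'a \<Rightarrow> 'a) \<Rightarrow> ('a \<Rightarrow> 'a) \<Rightarrow> ('a::{real_normed_algebra} \<Rightarrow> complex) \<Rightarrow> bool" where
  "is_trace sc st \<omega> \<longleftrightarrow> is_state sc st \<omega> \<and> (\<forall>a b. \<omega> (a * b) = \<omega> (b * a))"

definition positive_elem :: "('a \<Rightarrow> 'a) \<Rightarrow> 'a::times \<Rightarrow> bool" where
  "positive_elem st a \<longleftrightarrow> (\<exists>b. a = st b * b)"

definition omega_norm :: "('a \<Rightarrow> 'a) \<Rightarrow> ('a::times \<Rightarrow> complex) \<Rightarrow> 'a \<Rightarrow> real" where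
  "omega_norm st \<omega> a = sqrt (Re (\<omega> (st a * a)))"

definition totally_bounded_sn :: "('a \<Rightarrow> real) \<Rightarrow> 'a::minus set \<Rightarrow> bool" where
  "totally_bounded_sn p S \<longleftrightarrow>
     (\<forall>e>0. \<exists>F. finite F \<and> F \<subseteq> S \<and> (\<forall>x\<in>S. \<exists>y\<in>F. p (x - y) < e))"

definition compact_cstar_system ::
  "(complex \<Rightarrow> 'a \<Rightarrow> 'a) \<Rightarrow> ('a \<Rightarrow> 'a) \<Rightarrow> ('a::{real_normed_algebra, banach} \<Rightarrow> complex)
    \<Rightarrow> ('g::plus \<Rightarrow> 'a \<Rightarrow> 'a) \<Rightarrow> 'g set \<Rightarrow> bool" where
  "compact_cstar_system sc st \<omega> \<tau> K \<longleftrightarrow>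
     cstar_algebra sc st \<and> positive_functional sc st \<omega> \<and> semigroup_set K \<and>
     (\<forall>g\<in>K. clinear_on sc (\<tau> g)) \<and>
     (\<forall>g\<in>K. \<forall>h\<in>K. \<tau> g \<circ> \<tau> h = \<tau> (g + h)) \<and>
     (\<forall>g\<in>K. \<forall>a. omega_norm st \<omega> (\<tau> g a) = omega_norm st \<omega> a) \<and>
     (\<forall>g\<in>K. \<forall>a. norm (\<tau> g a) \<le> norm a) \<and>
     (\<forall>a. totally_bounded_sn (omega_norm st \<omega>) {\<tau> g a | g. g \<in> K})"

definition tau_pow :: "('g::ab_group_add \<Rightarrow> 'a \<Rightarrow> 'a) \<Rightarrow> 'g \<Rightarrow> nat \<Rightarrow> 'a \<Rightarrow> 'a" where
  "tau_pow \<tau> g m a = (if m = 0 then a else \<tau> (gpow m g) a)"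

fun ordprod :: "(nat \<Rightarrow> 'a::times) \<Rightarrow> nat \<Rightarrow> 'a" where
  "ordprod b 0 = b 0"
| "ordprod b (Suc k) = ordprod b k * b (Suc k)"

end

theory Submission
  imports Defs
begin

text \<open>If every \<open>b\<^sub>j\<close> is \<open>\<omega>\<close>-close to \<open>a\<close> and bounded in norm by \<open>\<parallel>a\<parallel>\<close>, then
  \<open>\<omega> (b\<^sub>0 \<cdots> b\<^sub>k)\<close> is close to \<open>\<omega> (a\<^bsup>k+1\<^esup>) > 0\<close>, because the trace property bounds multiplication
  from both sides in \<open>\<parallel>\<cdot>\<parallel>\<^sub>\<omega>\<close>. Hence the correlation is bounded below on the set \<open>E\<close> of
  simultaneous return times. By total boundedness, finitely many translates \<open>E - h\<close>, \<open>h \<in> H \<subseteq> K\<close>,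
  cover \<open>K\<close>, so for every \<open>n\<close> some translate \<open>\<Lambda>\<^sub>n + h\<close> meets \<open>E\<close> in a proportion of at least
  \<open>1 / |H|\<close>; these translates form the required Folner sequence.

  As the algebra has no unit, boundedness of \<open>\<omega>\<close> and its continuity in \<open>\<parallel>\<cdot>\<parallel>\<^sub>\<omega>\<close> rest on square
  roots in the unitization and on \<open>\<parallel>x - x\<^sup>3\<parallel> \<le> 1/2\<close> for selfadjoint contractions \<open>x\<close>.\<close>

section \<open>Square roots in a C*-algebra without unit\<close>

locale cstar =
  fixes sc :: "complex \<Rightarrow> 'a::{real_normed_algebra, banach} \<Rightarrow> 'a" and st :: "'a \<Rightarrow> 'a"
  assumes cstar_algebra: "cstar_algebra sc st"
begin

section \<open>Algebra of scalars and the star\<close>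

lemma
  shows sc_of_real: "sc (complex_of_real r) x = r *\<^sub>R x"
    and sc_sc: "sc c (sc d x) = sc (c * d) x"
    and sc_add_left: "sc (c + d) x = sc c x + sc d x"
    and sc_add_right: "sc c (x + y) = sc c x + sc c y"
    and mult_sc_left: "sc c x * y = sc c (x * y)"
    and mult_sc_right: "x * sc c y = sc c (x * y)"
    and norm_sc: "norm (sc c x) = cmod c * norm x"
    and st_st: "st (st x) = x"
    and st_add: "st (x + y) = st x + st y"
    and st_sc: "st (sc c x) = sc (cnj c) (st x)"
    and st_mult: "st (x * y) = st y * st x"
    and norm_st_mult: "norm (st x * x) = (norm x)\<^sup>2"
  using cstar_algebra unfolding cstar_algebra_def by metis+

lemma sc_minus_one: "sc (- 1) x = - x"
  using sc_of_real[of "-1" x] by simp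

lemma sc_one: "sc 1 x = x"
  using sc_of_real[of 1 x] by simp

lemma sc_minus_right: "sc c (- x) = - sc c x"
  by (metis add.right_inverse add_cancel_right_right minus_unique sc_add_right)

lemma sc_minus_left: "sc (- c) x = - sc c x"
  using sc_sc[of "-1" c x] by (simp add: sc_minus_one)

lemma sc_diff_right: "sc c (x - y) = sc c x - sc c y"
  using sc_add_right[of c x "- y"] by (simp add: sc_minus_right)

lemma st_scaleR: "st (r *\<^sub>R x) = r *\<^sub>R st x"
  using st_sc[of "complex_of_real r" x] by (simp add: sc_of_real)

lemma st_zero: "st 0 = 0"
  using st_add[of 0 0] by simp

lemma st_minus: "st (- x) = - st x"
  using st_scaleR[of "-1" x] by simp

lemma st_diff: "st (x - y) = st x - st y"
  using st_add[of x "- y"] by (simp add: st_minus)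

lemma norm_le_norm_st: "norm x \<le> norm (st x)"
proof (cases "x = 0")
  case False
  have "(norm x)\<^sup>2 \<le> norm (st x) * norm x"
    using norm_mult_ineq[of "st x" x] by (simp add: norm_st_mult)
  with False show ?thesis by (simp add: power2_eq_square)
qed simp

lemma norm_st: "norm (st x) = norm x"
  using norm_le_norm_st[of x] norm_le_norm_st[of "st x"] by (simp add: st_st)

lemma tendsto_st:
  assumes "f \<longlonglongrightarrow> l"
  shows "(\<lambda>n. st (f n)) \<longlonglongrightarrow> st l"
proof -
  have "bounded_linear st"
    by (rule bounded_linear_intro[where K = 1]) (auto simp: st_add st_scaleR norm_st)
  from bounded_linear.tendsto[OF this assms] show ?thesis .
qed

text \<open>Substitute for evaluation at a unit: testing on \<open>y = st z\<close>, the C*-identity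
  turns a bound for left multiplication into a bound for \<open>norm z\<close>.\<close>

lemma norm_le_of_left_mult_le:
  fixes z :: 'a
  assumes "\<And>y. norm (z * y) \<le> c * norm y" "0 \<le> c"
  shows "norm z \<le> c"
proof (cases "z = 0")
  case False
  have "norm (z * st z) = (norm z)\<^sup>2"
    using norm_st_mult[of "st z"] by (simp add: st_st norm_st)
  with assms(1)[of "st z"] have "(norm z)\<^sup>2 \<le> c * norm z" by (simp add: norm_st)
  with False show ?thesis by (simp add: power2_eq_square)
qed (use assms in simp)

lemma norm_sq_selfadj: "st x = x \<Longrightarrow> norm (x * x) = (norm x)\<^sup>2"
  using norm_st_mult[of x] by simp

text \<open>The iteration \<open>u \<mapsto> (u\<^sub>0 + u\<^sup>2) / 2\<close> in the unitization, where \<open>u\<^sub>0 = \<beta> + v\<close> is a multiplier of norm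
  at most one, converges to \<open>1 - sqrt (1 - u\<^sub>0)\<close>; its increments are dominated by those of the same
  iteration for the number one. Only the component in the algebra itself has to be carried along.\<close>

lemma sqrt_multiplier:
  assumes v: "st v = v" and \<beta>: "\<bar>\<beta>\<bar> \<le> 1" and u: "\<And>y. norm (\<beta> *\<^sub>R y + v * y) \<le> norm y"
  shows "\<exists>b w. st w = w \<and> \<bar>b\<bar> \<le> 1 \<and> 2 * b = \<beta> + b\<^sup>2 \<and> 2 *\<^sub>R w = v + (2 * b) *\<^sub>R w + w * w \<and>
    (\<forall>c. c * v = v * c \<longrightarrow> c * w = w * c)"
proof -
  \<comment> \<open>\<open>be n\<close> and \<open>w n\<close> are the scalar and algebra components
    of the multiplier \<open>U n\<close>; \<open>al\<close> is the majorizing iteration for the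
    number one.\<close>
  define al where "al = rec_nat (0::real) (\<lambda>_ r. (1 + r\<^sup>2) / 2)"
  define be where "be = rec_nat (0::real) (\<lambda>_ r. (\<beta> + r\<^sup>2) / 2)"
  define w where "w = rec_nat (0::'a) (\<lambda>n x. (1/2) *\<^sub>R (v + (2 * be n) *\<^sub>R x + x * x))"
  have al: "al 0 = 0" "\<And>n. al (Suc n) = (1 + (al n)\<^sup>2) / 2" by (auto simp: al_def)
  have be: "be 0 = 0" "\<And>n. be (Suc n) = (\<beta> + (be n)\<^sup>2) / 2" by (auto simp: be_def)
  have w: "w 0 = 0" "\<And>n. w (Suc n) = (1/2) *\<^sub>R (v + (2 * be n) *\<^sub>R w n + w n * w n)"
    by (auto simp: w_def)
  define U where "U n y = be n *\<^sub>R y + w n * y" for n y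
  have al01: "0 \<le> al n \<and> al n \<le> 1" for n
  proof (induction n)
    case (Suc n)
    then have "(al n)\<^sup>2 \<le> 1" by (simp add: power_le_one)
    then show ?case by (simp add: al)
  qed (simp add: al)
  have al_mono: "al n \<le> al (Suc n)" for n
    using sum_squares_bound[of "al n" 1] by (simp add: al)
  have be_le: "\<bar>be n\<bar> \<le> al n" for n
  proof (induction n)
    case (Suc n)
    then have "(be n)\<^sup>2 \<le> (al n)\<^sup>2" by (metis abs_le_square_iff abs_of_nonneg al01)
    moreover have "\<bar>\<beta> + (be n)\<^sup>2\<bar> \<le> 1 + (be n)\<^sup>2" using \<beta> zero_le_power2[of "be n"] by linarith
    ultimately show ?case unfolding al be by simp
  qed (simp add: al be)
  have comm: "c * w n = w n * c" if "c * v = v * c" for c n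
  proof (induction n)
    case (Suc n)
    have "c * (w n * w n) = w n * w n * c"
      by (metis Suc mult.assoc)
    then show ?case using Suc that by (simp add: w algebra_simps)
  qed (simp add: w)
  have wv: "w n * v = v * w n" for n using comm[of v n] by simp
  have ww: "w i * w j = w j * w i" for i j using comm[OF wv] .
  have st_w: "st (w n) = w n" for n
    by (induction n) (auto simp: w st_zero st_scaleR st_add st_mult v)
  have U_Suc: "U (Suc n) y = (1/2) *\<^sub>R (\<beta> *\<^sub>R y + v * y + U n (U n y))" for n y
  proof -
    have "2 *\<^sub>R U (Suc n) y = \<beta> *\<^sub>R y + v * y + U n (U n y)"
      by (simp add: U_def be w algebra_simps power2_eq_square scaleR_2)
        (simp add: add_divide_distrib scaleR_add_left flip: scaleR_2)
    from arg_cong[OF this, of "scaleR (1/2)"] show ?thesis by simp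
  qed
  have U_le: "norm (U n y) \<le> al n * norm y" for n y
  proof (induction n arbitrary: y)
    case (Suc n)
    have "norm (U n (U n y)) \<le> al n * (al n * norm y)"
      by (meson Suc al01 mult_left_mono order_trans)
    then have "norm (\<beta> *\<^sub>R y + v * y + U n (U n y)) \<le> norm y + al n * (al n * norm y)"
      by (intro norm_triangle_le add_mono u)
    then have "norm (U (Suc n) y) \<le> (norm y + al n * (al n * norm y)) / 2"
      unfolding U_Suc norm_scaleR by simp
    then show ?case by (simp add: al power2_eq_square algebra_simps)
  qed (simp add: U_def be w al)
  have U_diff: "U n (x - y) = U n x - U n y" for n x y
    by (simp add: U_def algebra_simps)
  have U_comm: "U i (U j y) = U j (U i y)" for i j y
  proof -
    have "w i * (w j * y) = w j * (w i * y)" by (metis ww mult.assoc)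
    then show ?thesis by (simp add: U_def algebra_simps)
  qed
  \<comment> \<open>Difference of squares; the commuting multipliers \<open>U n\<close> and the
    scalars \<open>be n\<close> factor in the same way, so increments compare inductively.\<close>
  have al_diff: "al (Suc (Suc n)) - al (Suc n) = (al (Suc n) + al n) / 2 * (al (Suc n) - al n)" for n
    unfolding al(2)[of "Suc n"] al(2)[of n]  by (simp add: power2_eq_square field_simps)
  have D_le: "norm (U (Suc n) y - U n y) \<le> (al (Suc n) - al n) * norm y" for n y
  proof (induction n arbitrary: y)
    case 0
    then show ?case using U_le[of "Suc 0" y] by (simp add: U_def be(1) w(1) al(1))
  next
    case (Suc n)
    define d where "d = U (Suc n) y - U n y"
    have "U (Suc (Suc n)) y - U (Suc n) y = (1/2) *\<^sub>R (U (Suc n) (U (Suc n) y) - U n (U n y))"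
      unfolding U_Suc[of "Suc n"] U_Suc[of n y] by (simp add: algebra_simps)
    also have "U (Suc n) (U (Suc n) y) - U n (U n y) = U (Suc n) d + U n d"
      unfolding d_def U_diff by (simp add: U_comm)
    finally have "norm (U (Suc (Suc n)) y - U (Suc n) y) \<le> (norm (U (Suc n) d) + norm (U n d)) / 2"
      using norm_triangle_ineq[of "U (Suc n) d" "U n d"] by simp
    also have "\<dots> \<le> (al (Suc n) * norm d + al n * norm d) / 2"
      by (intro divide_right_mono add_mono U_le) auto
    also have "\<dots> = (al (Suc n) + al n) / 2 * norm d" by (simp add: algebra_simps)
    also have "\<dots> \<le> (al (Suc n) + al n) / 2 * ((al (Suc n) - al n) * norm y)"
      using al01 Suc[of y] unfolding d_def by (intro mult_left_mono) auto
    finally show ?case by (simp add: al_diff)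
  qed
  have be_diff: "\<bar>be (Suc n) - be n\<bar> \<le> al (Suc n) - al n" for n
  proof (induction n)
    case 0
    then show ?case using be_le[of "Suc 0"] by (simp add: be(1) al(1))
  next
    case (Suc n)
    have "be (Suc (Suc n)) - be (Suc n) = (be (Suc n) + be n) / 2 * (be (Suc n) - be n)"
      unfolding be(2)[of "Suc n"] be(2)[of n] by (simp add: power2_eq_square field_simps)
    then have "\<bar>be (Suc (Suc n)) - be (Suc n)\<bar> = \<bar>(be (Suc n) + be n) / 2\<bar> * \<bar>be (Suc n) - be n\<bar>"
      by (simp only: abs_mult)
    also have "\<dots> \<le> (al (Suc n) + al n) / 2 * (al (Suc n) - al n)"
      using be_le[of n] be_le[of "Suc n"] al01[of n] al01[of "Suc n"] Suc
      by (intro mult_mono) auto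
    finally show ?case by (simp add: al_diff)
  qed
  \<comment> \<open>The algebra component is the multiplier minus its scalar component; each
    increment costs \<open>al (Suc n) - al n\<close>, hence the factor two.\<close>
  have w_diff: "norm (w (Suc n) - w n) \<le> 2 * (al (Suc n) - al n)" for n
  proof (rule norm_le_of_left_mult_le)
    fix y
    have "(w (Suc n) - w n) * y = (U (Suc n) y - U n y) - (be (Suc n) - be n) *\<^sub>R y"
      unfolding U_def by (simp add: algebra_simps)
    then have "norm ((w (Suc n) - w n) * y)
        \<le> norm (U (Suc n) y - U n y) + \<bar>be (Suc n) - be n\<bar> * norm y"
      using norm_triangle_ineq4 by (metis norm_scaleR)
    also have "\<dots> \<le> (al (Suc n) - al n) * norm y + (al (Suc n) - al n) * norm y"
      by (intro add_mono D_le mult_right_mono be_diff) auto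
    finally show "norm ((w (Suc n) - w n) * y) \<le> 2 * (al (Suc n) - al n) * norm y"
      by (simp add: algebra_simps)
  qed (use al_mono[of n] in simp)
  obtain l where "al \<longlonglongrightarrow> l"
    by (rule incseq_convergent[of al 1]) (auto intro: incseq_SucI al_mono simp: al01)
  then have sum_al: "summable (\<lambda>n. 2 * (al (Suc n) - al n))"
    by (intro summable_mult telescope_summable)
  have conv: "convergent f" if f: "\<And>n. norm (f (Suc n) - f n) \<le> 2 * (al (Suc n) - al n)"
    for f :: "nat \<Rightarrow> 'z::banach"
  proof -
    have "summable (\<lambda>n. f (Suc n) - f n)"
      by (rule summable_comparison_test'[OF sum_al]) (use f in auto)
    then have "convergent (\<lambda>n. \<Sum>i<n. f (Suc i) - f i)" by (simp add: summable_iff_convergent)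
    then show ?thesis unfolding sum_lessThan_telescope
      by (metis add_diff_cancel_left' convergent_add convergent_const convergent_diff_const_right_iff)
  qed
  obtain W where W: "w \<longlonglongrightarrow> W" using conv[of w, OF w_diff] by (auto simp: convergent_def)
  have "norm (be (Suc n) - be n) \<le> 2 * (al (Suc n) - al n)" for n
    using be_diff[of n] al_mono[of n] by simp
  from conv[of be, OF this] obtain b where b: "be \<longlonglongrightarrow> b" by (auto simp: convergent_def)
  have "(\<lambda>n. 2 * be (Suc n)) \<longlonglongrightarrow> \<beta> + b\<^sup>2" 
  proof -
    have "2 * be (Suc n) = \<beta> + (be n)\<^sup>2" for n by (simp add: be field_simps)
    then show ?thesis using tendsto_add[OF tendsto_const tendsto_power[OF b], of \<beta> 2] by simp
  qed
  moreover have "(\<lambda>n. 2 * be (Suc n)) \<longlonglongrightarrow> 2 * b" by (intro tendsto_intros LIMSEQ_Suc b)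
  ultimately have b_eq: "2 * b = \<beta> + b\<^sup>2" using LIMSEQ_unique by blast
  have "(\<lambda>n. w (Suc n)) \<longlonglongrightarrow> (1/2) *\<^sub>R (v + (2 * b) *\<^sub>R W + W * W)"
    unfolding w by (intro tendsto_intros b W)
  with W have "W = (1/2) *\<^sub>R (v + (2 * b) *\<^sub>R W + W * W)" using LIMSEQ_unique LIMSEQ_Suc by blast
  then have W_eq: "2 *\<^sub>R W = v + (2 * b) *\<^sub>R W + W * W"
    by (metis (no_types, lifting) divide_self_if scaleR_one scaleR_scaleR times_divide_eq_right
        mult.right_neutral zero_neq_numeral)
  have "\<bar>be n\<bar> \<le> 1" for n using be_le[of n] al01[of n] by simp
  then have "\<bar>b\<bar> \<le> 1" using tendsto_rabs[OF b] LIMSEQ_le_const2 by blast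
  moreover have "st W = W" using tendsto_st[OF W] LIMSEQ_unique W by (simp add: st_w)
  moreover have "c * W = W * c" if "c * v = v * c" for c
  proof -
    have "(\<lambda>n. c * w n) \<longlonglongrightarrow> c * W" "(\<lambda>n. w n * c) \<longlonglongrightarrow> W * c" by (intro tendsto_intros W)+
    then show ?thesis using LIMSEQ_unique by (simp add: comm[OF that])
  qed
  ultimately show ?thesis using b_eq W_eq by blast
qed

text \<open>With \<open>\<beta> = 0\<close> the scalar component vanishes and \<open>w\<close>
  stands for \<open>1 - sqrt (1 - x)\<close>; the equation is a unit-free form of
  \<open>(1 - w)\<^sup>2 = 1 - x\<close>.\<close>

lemma sqrt_one_minus:
  assumes "st x = x" "norm x \<le> 1"
  obtains w where "st w = w" "2 *\<^sub>R w - w * w = x" "\<And>c. c * x = x * c \<Longrightarrow> c * w = w * c"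
proof -
  have "norm (0 *\<^sub>R y + x * y) \<le> norm y" for y
    using norm_mult_ineq[of x y] mult_right_mono[OF assms(2), of "norm y"] by simp
  from sqrt_multiplier[OF assms(1) _ this] obtain b w where *: "st w = w" "\<bar>b\<bar> \<le> 1" "2 * b = 0 + b\<^sup>2"
    "2 *\<^sub>R w = x + (2 * b) *\<^sub>R w + w * w" "\<And>c. c * x = x * c \<Longrightarrow> c * w = w * c"
    unfolding abs_zero using zero_le_one by blast
  have "b = 0 \<or> b = 2" using *(3) by (simp add: power2_eq_square) 
  with *(2) have "b = 0" by auto
  show ?thesis
  proof (rule that[of w])
    show "2 *\<^sub>R w - w * w = x" using *(4) \<open>b = 0\<close> by simp
  qed (use * in blast)+
qed

text \<open>\<open>\<parallel>1 - x\<parallel> \<le> 1\<close> in the multiplier algebra: a closed convex condition that forces a selfadjoint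
  \<open>x\<close> to be positive.\<close>

definition unit_near :: "'a \<Rightarrow> bool" where
  "unit_near x \<longleftrightarrow> st x = x \<and> (\<forall>y. norm (y - x * y) \<le> norm y)"

text \<open>For the multiplier \<open>1 - t\<close> the limit \<open>1 - sqrt t\<close> has scalar
  component one, which leaves \<open>w = - sqrt t\<close> in the algebra itself.\<close>

lemma unit_near_sqrt:
  assumes "unit_near t"
  obtains s where "st s = s" "s * s = t"
proof -
  have "norm (1 *\<^sub>R y + (- t) * y) \<le> norm y" for y using assms by (simp add: unit_near_def)
  moreover have "st (- t) = - t" using assms by (simp add: unit_near_def st_minus)
  ultimately obtain b w where *: "st w = w" "2 * b = 1 + b\<^sup>2"
    "2 *\<^sub>R w = - t + (2 * b) *\<^sub>R w + w * w"
    using sqrt_multiplier[of "- t" 1] unfolding abs_one by blast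
  have "(b - 1)\<^sup>2 = 0" using *(2) by (simp add: power2_eq_square algebra_simps)
  then have "b = 1" by simp
  with *(3) have "w * w = t" by simp
  with *(1) show ?thesis by (rule that)
qed

text \<open>Both bounds come from the unitary \<open>x + i sqrt (1 - x\<^sup>2)\<close> and its square.\<close>

lemma unitary_bounds:
  assumes x: "st x = x" and w: "st w = w" "2 *\<^sub>R w - w * w = x * x" "x * w = w * x"
  shows "norm (y - w * y) \<le> norm y" and "norm (x * (y - w * y)) \<le> norm y / 2"
proof -
  define P where "P y = y - w * y" for y
  have P_st: "st (P y) * z = st y * P z" for y z
    by (simp add: P_def st_diff st_mult w algebra_simps)
  have P_x: "P (x * y) = x * P y" for y
    unfolding P_def using w(3) by (metis (no_types) mult.assoc right_diff_distrib)
  have PP: "P (P y) = y - x * (x * y)" for y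
    unfolding P_def mult.assoc[symmetric] w(2)[symmetric] by (simp add: algebra_simps scaleR_2)
  have P_sc: "P (sc c y) = sc c (P y)" for c y
    by (simp add: P_def sc_diff_right mult_sc_right)
  have P_add: "P (y + z) = P y + P z" for y z by (simp add: P_def algebra_simps)
  \<comment> \<open>\<open>P\<close> multiplies by \<open>1 - w\<close>, a square root of
    \<open>1 - x\<^sup>2\<close>. Since \<open>cnj c = - c\<close>, the cross terms cancel, and the
    squares add up to one.\<close>
  have iso: "norm (x * y + sc c (P y)) = norm y" if c: "c * cnj c = 1" "cnj c = - c" for c y
  proof -
    have "st (x * y + sc c (P y)) * (x * y + sc c (P y))
        = st y * (x * (x * y) + sc c (x * P y)) + sc (cnj c) (st y * (P (x * y) + sc c (P (P y))))"
      by (simp add: st_add st_mult st_sc x mult_sc_left mult_sc_right P_st P_add P_sc algebra_simps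
          sc_add_right sc_sc)
    also have "\<dots> = st y * y"
    proof -
      have "c * c = - 1" using c by (metis minus_minus mult_minus_right)
      then have "sc (cnj c) (st y * (P (x * y) + sc c (P (P y))))
          = - sc c (st y * (x * P y)) + st y * (y - x * (x * y))"
        by (simp add: P_x PP c(2) distrib_left sc_add_right mult_sc_right sc_sc sc_one sc_minus_left)
      then show ?thesis by (simp add: distrib_left right_diff_distrib mult_sc_right)
    qed
    finally have "(norm (x * y + sc c (P y)))\<^sup>2 = (norm y)\<^sup>2" by (metis norm_st_mult)
    then show ?thesis by simp
  qed
  define U where "U c y = x * y + sc c (P y)" for c y
  have U: "norm (U \<i> y) = norm y" "norm (U (- \<i>) y) = norm y" for y
    unfolding U_def by (rule iso; simp)+
  have "U \<i> y - U (- \<i>) y = sc (2 * \<i>) (P y)"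
    using sc_add_left[of \<i> \<i>] by (simp add: U_def sc_minus_left)
  then have "2 * norm (P y) \<le> norm y + norm y"
    using norm_triangle_ineq4[of "U \<i> y" "U (- \<i>) y"] by (simp add: U norm_sc norm_mult)
  then show "norm (y - w * y) \<le> norm y" by (simp add: P_def)
  have UU: "U c (U c y) = x * (x * y) + sc (c * c) (P (P y)) + 2 *\<^sub>R sc c (x * P y)" for c
    by (simp add: U_def P_add P_x P_sc distrib_left mult_sc_right sc_add_right sc_sc scaleR_2)
  \<comment> \<open>The double angle formula isolates \<open>x * P y\<close> with the factor four;
    two isometries bound the left side by \<open>2 * norm y\<close>.\<close>
  have "U \<i> (U \<i> y) - U (- \<i>) (U (- \<i>) y) = 4 *\<^sub>R sc \<i> (x * P y)"
    unfolding UU by (simp add: sc_minus_left flip: scaleR_add_left)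
  then have "4 * norm (x * P y) \<le> norm y + norm y"
    using norm_triangle_ineq4[of "U \<i> (U \<i> y)" "U (- \<i>) (U (- \<i>) y)"] by (simp add: U norm_sc)
  then show "norm (x * (y - w * y)) \<le> norm y / 2" by (simp add: P_def)
qed

text \<open>As multipliers, \<open>1 - x\<^sup>2\<close> is the square of the contraction
  \<open>1 - w\<close>, and \<open>x - x\<^sup>3\<close> is \<open>x (1 - w)\<close>, of norm at
  most one half, times \<open>1 - w\<close>.\<close>

lemma
  assumes x: "st x = x" "norm x \<le> 1"
  shows unit_near_square: "unit_near (x * x)"
    and norm_diff_cube: "norm (x - x * x * x) \<le> 1 / 2"
proof -
  have "st (x * x) = x * x" "norm (x * x) \<le> 1"
    using x by (auto simp: st_mult norm_sq_selfadj power_le_one)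
  then obtain w where w: "st w = w" "2 *\<^sub>R w - w * w = x * x"
    "\<And>c. c * (x * x) = x * x * c \<Longrightarrow> c * w = w * c"
    using sqrt_one_minus by blast
  have "x * w = w * x" using w(3)[of x] by (simp add: mult.assoc)
  note u = unitary_bounds[OF x(1) w(1,2) this]
  have eq: "y - x * x * y = (y - w * y) - w * (y - w * y)" for y
    unfolding w(2)[symmetric] by (simp add: algebra_simps scaleR_2)
  show "unit_near (x * x)"
    unfolding unit_near_def eq using x u(1) by (auto simp: st_mult intro: order_trans)
  show "norm (x - x * x * x) \<le> 1 / 2"
  proof (rule norm_le_of_left_mult_le)
    fix y
    have "(x - x * x * x) * y = x * (y - x * x * y)" by (simp add: algebra_simps)
    also have "norm \<dots> \<le> norm (y - w * y) / 2" unfolding eq by (rule u(2))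
    also have "\<dots> \<le> 1 / 2 * norm y" using u(1) by simp
    finally show "norm ((x - x * x * x) * y) \<le> 1 / 2 * norm y" .
  qed simp
qed

lemma norm_le_2_of_unit_near:
  assumes "unit_near t"
  shows "norm t \<le> 2"
proof (rule norm_le_of_left_mult_le)
  fix y
  have "norm (t * y) = norm (y - (y - t * y))" by simp
  also have "\<dots> \<le> norm y + norm (y - t * y)" by (rule norm_triangle_ineq4)
  also have "\<dots> \<le> 2 * norm y" using assms by (simp add: unit_near_def)
  finally show "norm (t * y) \<le> 2 * norm y" .
qed simp

text \<open>The weights sum to one, so the series is a countable convex combination and the
  inequality in \<open>unit_near\<close> averages; it converges because the terms \<open>t n\<close>
  have norm at most two.\<close>

lemma
  assumes t: "\<And>n. unit_near (t n)"
  shows summable_unit_near: "summable (\<lambda>n. (1/2) ^ Suc n *\<^sub>R t n)"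
    and unit_near_suminf: "unit_near (\<Sum>n. (1/2) ^ Suc n *\<^sub>R t n)"
proof -
  show s: "summable (\<lambda>n. (1/2) ^ Suc n *\<^sub>R t n)"
  proof (rule summable_comparison_test')
    show "summable (\<lambda>n. (1/2::real) ^ n)" by (rule summable_geometric) simp
    show "norm ((1/2) ^ Suc n *\<^sub>R t n) \<le> (1/2) ^ n" for n
      using norm_le_2_of_unit_near[OF t, of n] by simp
  qed
  have half: "(\<lambda>n. (1/2) ^ Suc n) sums (1::real)" by (rule power_half_series)
  define T where "T = (\<Sum>n. (1/2) ^ Suc n *\<^sub>R t n)"
  have T: "(\<lambda>n. (1/2) ^ Suc n *\<^sub>R t n) sums T" unfolding T_def by (rule summable_sums[OF s])
  have "st T = T"
  proof -
    have "bounded_linear st"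
      by (rule bounded_linear_intro[where K = 1]) (auto simp: st_add st_scaleR norm_st)
    from bounded_linear.sums[OF this T] show ?thesis
      using t T by (simp add: st_scaleR unit_near_def sums_unique2)
  qed
  moreover have "norm (y - T * y) \<le> norm y" for y
  proof -
    have "(\<lambda>n. (1/2) ^ Suc n *\<^sub>R y - (1/2) ^ Suc n *\<^sub>R t n * y) sums (1 *\<^sub>R y - T * y)"
      by (intro sums_diff sums_mult2 T bounded_linear.sums[OF bounded_linear_scaleR_left half])
    then have e: "(\<lambda>n. (1/2) ^ Suc n *\<^sub>R (y - t n * y)) sums (y - T * y)"
      by (simp add: scaleR_diff_right)
    have "norm (\<Sum>n. (1/2) ^ Suc n *\<^sub>R (y - t n * y)) \<le> (\<Sum>n. (1/2) ^ Suc n * norm y)"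
    proof (rule norm_suminf_le)
      show "norm ((1/2) ^ Suc n *\<^sub>R (y - t n * y)) \<le> (1/2) ^ Suc n * norm y" for n
        using t[of n] by (simp add: unit_near_def)
      show "summable (\<lambda>n. (1/2) ^ Suc n * norm y)"
        by (rule sums_summable[OF sums_mult2[OF half]])
    qed
    then show ?thesis
      using sums_unique[OF e] sums_unique[OF sums_mult2[OF half, of "norm y"]] by simp
  qed
  ultimately show "unit_near (\<Sum>n. (1/2) ^ Suc n *\<^sub>R t n)" unfolding unit_near_def T_def by blast
qed

text \<open>Polarization: \<open>z\<^sup>3\<close> is the difference of the squares of
  \<open>(z + z\<^sup>2) / 2\<close> and \<open>(z - z\<^sup>2) / 2\<close>, both selfadjoint
  contractions.\<close>

lemma cube_eq_unit_near_diff: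
  assumes z: "st z = z" "norm z \<le> 1"
  obtains p q where "unit_near p" "unit_near q" "z * z * z = p - q"
proof -
  have "norm (z * z) \<le> 1" using z by (simp add: norm_sq_selfadj power_le_one)
  then have le: "norm (z + z * z) \<le> 2" "norm (z - z * z) \<le> 2"
    using norm_triangle_ineq[of z "z * z"] norm_triangle_ineq4[of z "z * z"] z(2) by auto
  define h where "h c = (1/2) *\<^sub>R (z + c *\<^sub>R (z * z))" for c
  have "unit_near (h c * h c)" if "c = 1 \<or> c = - 1" for c
    by (rule unit_near_square) (use that le in \<open>auto simp: h_def st_scaleR st_add st_mult z\<close>)
  moreover have "z * z * z = h 1 * h 1 - h (- 1) * h (- 1)"
    by (simp add: h_def algebra_simps) (simp flip: scaleR_add_left)
  ultimately show ?thesis using that by blast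
qed

text \<open>Cubes split, and twice the remainder \<open>z - z\<^sup>3\<close> is again a selfadjoint
  contraction. Iterating writes \<open>x\<close> as the sum of the cubes of \<open>z n\<close> with
  weights \<open>(1/2) ^ n\<close>; the two parts of the cubes are then summed separately.\<close>

lemma selfadj_eq_unit_near_diff:
  assumes x: "st x = x" "norm x \<le> 1"
  obtains p q where "unit_near p" "unit_near q" "x = 2 *\<^sub>R (p - q)"
proof -
  define z where "z = rec_nat x (\<lambda>_ z. 2 *\<^sub>R (z - z * z * z))"
  have z: "z 0 = x" "\<And>n. z (Suc n) = 2 *\<^sub>R (z n - z n * z n * z n)" by (auto simp: z_def)
  have zz: "st (z n) = z n \<and> norm (z n) \<le> 1" for n
  proof (induction n)
    case (Suc n)
    then show ?case using norm_diff_cube[of "z n"]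
      by (simp add: z st_scaleR st_diff st_mult mult.assoc)
  qed (simp add: z x)
  then have "\<forall>n. \<exists>p q. unit_near p \<and> unit_near q \<and> z n * z n * z n = p - q" using cube_eq_unit_near_diff by metis
  then obtain p q where pq: "\<And>n. unit_near (p n)" "\<And>n. unit_near (q n)" "\<And>n. z n * z n * z n = p n - q n"
    by metis
  define P where "P = (\<Sum>n. (1/2) ^ Suc n *\<^sub>R p n)"
  define Q where "Q = (\<Sum>n. (1/2) ^ Suc n *\<^sub>R q n)"
  have "(\<lambda>n. (1/2) ^ Suc n *\<^sub>R p n - (1/2) ^ Suc n *\<^sub>R q n) sums (P - Q)"
    unfolding P_def Q_def by (intro sums_diff summable_sums summable_unit_near pq)
  then have lim: "(\<lambda>N. \<Sum>n<N. (1/2) ^ Suc n *\<^sub>R (p n - q n)) \<longlonglongrightarrow> P - Q"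
    by (simp add: scaleR_diff_right sums_def)
  have part: "(\<Sum>n<N. (1/2) ^ Suc n *\<^sub>R (p n - q n)) = (1/2) *\<^sub>R x - (1/2) ^ Suc N *\<^sub>R z N" for N
  proof (induction N)
    case (Suc N)
    then show ?case by (simp add: z pq(3)[symmetric] scaleR_diff_right)
  qed (simp add: z)
  have "(\<lambda>N. (1/2) ^ Suc N *\<^sub>R z N) \<longlonglongrightarrow> 0"
  proof (rule Lim_null_comparison)
    show "\<forall>\<^sub>F N in sequentially. norm ((1/2) ^ Suc N *\<^sub>R z N) \<le> (1/2) ^ N"
    proof (intro always_eventually allI)
      show "norm ((1/2) ^ Suc N *\<^sub>R z N) \<le> (1/2) ^ N" for N using zz[of N] by simp
    qed
    show "(\<lambda>N. (1/2::real) ^ N) \<longlonglongrightarrow> 0" by (rule LIMSEQ_realpow_zero) auto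
  qed
  then have "(\<lambda>N. (1/2) *\<^sub>R x - (1/2) ^ Suc N *\<^sub>R z N) \<longlonglongrightarrow> (1/2) *\<^sub>R x - 0"
    by (intro tendsto_diff tendsto_const)
  with lim have "P - Q = (1/2) *\<^sub>R x" unfolding part using LIMSEQ_unique by fastforce
  then have "x = 2 *\<^sub>R (P - Q)" by simp
  moreover have "unit_near P" "unit_near Q" unfolding P_def Q_def by (intro unit_near_suminf pq)+
  ultimately show ?thesis using that by blast
qed

end

section \<open>Positive tracial functionals\<close>

locale cstar_trace = cstar sc st
  for sc :: "complex \<Rightarrow> 'a::{real_normed_algebra, banach} \<Rightarrow> 'a" and st :: "'a \<Rightarrow> 'a" +
  fixes \<omega> :: "'a \<Rightarrow> complex"
  assumes positive_functional: "positive_functional sc st \<omega>"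
    and trace: "\<omega> (x * y) = \<omega> (y * x)"
begin

abbreviation on :: "'a \<Rightarrow> real" where
  "on \<equiv> omega_norm st \<omega>"

lemma
  shows om_add: "\<omega> (x + y) = \<omega> x + \<omega> y"
    and om_sc: "\<omega> (sc c x) = c * \<omega> x"
    and om_st_mult_nonneg: "Im (\<omega> (st x * x)) = 0" "0 \<le> Re (\<omega> (st x * x))"
  using positive_functional unfolding positive_functional_def by auto

lemma om_scaleR: "\<omega> (r *\<^sub>R x) = complex_of_real r * \<omega> x"
  using om_sc[of "complex_of_real r" x] by (simp add: sc_of_real)

lemma om_minus: "\<omega> (- x) = - \<omega> x"
  using om_scaleR[of "-1" x] by simp

lemma om_diff: "\<omega> (x - y) = \<omega> x - \<omega> y"
  using om_add[of x "- y"] by (simp add: om_minus)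

lemma on_nonneg: "0 \<le> on x"
  by (simp add: omega_norm_def om_st_mult_nonneg)

lemma om_st_mult_self: "\<omega> (st x * x) = complex_of_real ((on x)\<^sup>2)"
  by (simp add: complex_eq_iff omega_norm_def om_st_mult_nonneg)

lemma om_expand:
  "\<omega> (st (x + sc c y) * (x + sc c y))
    = \<omega> (st x * x) + c * \<omega> (st x * y) + cnj c * \<omega> (st y * x) + c * cnj c * \<omega> (st y * y)"
  by (simp add: st_add st_sc algebra_simps mult_sc_left mult_sc_right om_add om_sc sc_sc)

text \<open>Polarization: the form is real at \<open>x + y\<close> and at \<open>x + \<i> y\<close>,
  which compares the imaginary and the real parts respectively.\<close>

lemma om_st_mult_commute: "\<omega> (st y * x) = cnj (\<omega> (st x * y))"
proof -
  have "Im (\<omega> (st (x + sc c y) * (x + sc c y))) = 0" for c by (rule om_st_mult_nonneg)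
  from this[of 1] this[of \<i>] show ?thesis
    by (simp add: om_expand om_st_mult_nonneg complex_eq_iff)
qed

lemma cauchy_schwarz: "cmod (\<omega> (st x * y)) \<le> on x * on y"
proof -
  define p where "p = \<omega> (st x * y)"
  define X where "X = (on x)\<^sup>2"
  define Y where "Y = (on y)\<^sup>2"
  have q: "0 \<le> X - 2 * t * (cmod p)\<^sup>2 + t\<^sup>2 * (cmod p)\<^sup>2 * Y" for t
  proof -
    define c where "c = - complex_of_real t * cnj p"
    have "\<omega> (st (x + sc c y) * (x + sc c y))
        = complex_of_real (X - 2 * t * (cmod p)\<^sup>2 + t\<^sup>2 * (cmod p)\<^sup>2 * Y)"
      unfolding om_expand om_st_mult_commute[of y x] om_st_mult_self[of x] om_st_mult_self[of y]
        p_def[symmetric] X_def[symmetric] Y_def[symmetric]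
      by (simp add: c_def power2_eq_square[of t] algebra_simps complex_norm_square del: of_real_power)
    then show ?thesis using om_st_mult_nonneg(2)[of "x + sc c y"] by simp
  qed
  have "(cmod p)\<^sup>2 \<le> X * Y"
  \<comment> \<open>For \<open>Y = 0\<close> the quadratic in \<open>t\<close> is affine and would
    become negative for large \<open>t\<close>; otherwise \<open>t = 1 / Y\<close> gives its
    minimum.\<close>
  proof (cases "Y = 0")
    case True
    show ?thesis
    proof (rule ccontr)
      assume "\<not> ?thesis"
      then have "(cmod p)\<^sup>2 > 0" using True by simp
      with q[of "(X + 1) / (2 * (cmod p)\<^sup>2)"] True show False by simp
    qed
  next
    case False
    then have "Y > 0" by (simp add: Y_def)
    with q[of "1 / Y"] show ?thesis by (simp add: field_simps power2_eq_square)
  qed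
  then have "(cmod p)\<^sup>2 \<le> (on x * on y)\<^sup>2" by (simp add: X_def Y_def power_mult_distrib)
  then show ?thesis unfolding p_def by (rule power2_le_imp_le) (simp add: on_nonneg)
qed

lemma on_sc: "on (sc c x) = cmod c * on x"
proof -
  have "\<omega> (st (sc c x) * sc c x) = c * cnj c * \<omega> (st x * x)"
    by (simp add: st_sc mult_sc_left mult_sc_right sc_sc om_sc)
  also have "\<dots> = complex_of_real ((cmod c * on x)\<^sup>2)"
    by (simp add: om_st_mult_self power_mult_distrib flip: complex_norm_square)
  finally show ?thesis
    unfolding omega_norm_def[of _ _ "sc c x"] by (simp add: on_nonneg del: of_real_power)
qed

lemma on_scaleR: "on (r *\<^sub>R x) = \<bar>r\<bar> * on x"
  using on_sc[of "complex_of_real r" x] by (simp add: sc_of_real)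

lemma on_triangle: "on (x + y) \<le> on x + on y"
proof (rule power2_le_imp_le)
  have "\<omega> (st (x + y) * (x + y)) = \<omega> (st x * x) + \<omega> (st x * y) + cnj (\<omega> (st x * y)) + \<omega> (st y * y)"
    using om_expand[of x 1 y] om_st_mult_commute[of y x] by (simp add: sc_one)
  then have "complex_of_real ((on (x + y))\<^sup>2)
      = complex_of_real ((on x)\<^sup>2 + 2 * Re (\<omega> (st x * y)) + (on y)\<^sup>2)"
    unfolding om_st_mult_self by (simp add: complex_eq_iff)
  then have "(on (x + y))\<^sup>2 = (on x)\<^sup>2 + 2 * Re (\<omega> (st x * y)) + (on y)\<^sup>2"
    using of_real_eq_iff by blast
  also have "\<dots> \<le> (on x)\<^sup>2 + 2 * (on x * on y) + (on y)\<^sup>2"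
    using cauchy_schwarz[of x y] complex_Re_le_cmod[of "\<omega> (st x * y)"] by simp
  finally show "(on (x + y))\<^sup>2 \<le> (on x + on y)\<^sup>2" by (simp add: power2_sum)
qed (simp add: on_nonneg)

lemma on_triangle_diff: "on (x - y) \<le> on x + on y"
  using on_triangle[of x "- y"] on_scaleR[of "-1" y] by simp

lemma on_minus_commute: "on (x - y) = on (y - x)"
  using on_scaleR[of "-1" "y - x"] by simp

text \<open>For the contraction \<open>u = x / norm x\<close>, the element
  \<open>st y * (1 - st u * u) * y\<close> is positive: with \<open>1 - w\<close> a square root of
  \<open>1 - st u * u\<close>, it equals \<open>st (y - w * y) * (y - w * y)\<close>.\<close>

lemma on_mult_left: "on (x * y) \<le> norm x * on y"
proof (cases "x = 0")
  case True
  then show ?thesis using om_scaleR[of 0 0] by (simp add: omega_norm_def)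
next
  case False
  define u where "u = (1 / norm x) *\<^sub>R x"
  have "norm (st u * u) \<le> 1" using False unfolding norm_st_mult by (simp add: u_def)
  moreover have "st (st u * u) = st u * u" by (simp add: st_mult st_st)
  ultimately obtain w where w: "st w = w" "2 *\<^sub>R w - w * w = st u * u"
    using sqrt_one_minus by blast
  have "st (y - w * y) * (y - w * y) = st y * y - st y * ((2 *\<^sub>R w - w * w) * y)"
    by (simp add: st_diff st_mult w(1) algebra_simps scaleR_2)
  also have "\<dots> = st y * y - st (u * y) * (u * y)"
    by (simp add: w(2) st_mult mult.assoc)
  finally have "\<omega> (st (y - w * y) * (y - w * y)) = complex_of_real ((on y)\<^sup>2 - (on (u * y))\<^sup>2)"
    by (simp add: om_diff om_st_mult_self)
  then have "(on (u * y))\<^sup>2 \<le> (on y)\<^sup>2" using om_st_mult_nonneg(2)[of "y - w * y"] by simp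
  then have "on (u * y) \<le> on y" by (rule power2_le_imp_le) (rule on_nonneg)
  then show ?thesis using False by (simp add: u_def on_scaleR field_simps)
qed

lemma on_st: "on (st x) = on x"
  using trace[of x "st x"] by (simp add: omega_norm_def st_st)

text \<open>The trace makes the star isometric for the seminorm, so right multiplication reduces to
  left multiplication.\<close>

lemma on_mult_right: "on (x * y) \<le> on x * norm y"
  using on_mult_left[of "st y" "st x"] on_st[of "x * y"]
  by (simp add: st_mult on_st norm_st mult.commute)

section \<open>Boundedness of \<open>\<omega>\<close> and continuity in its seminorm\<close>

lemma om_unit_near_nonneg:
  assumes "unit_near t"
  shows "0 \<le> Re (\<omega> t)" "Im (\<omega> t) = 0"
proof -
  obtain s where "st s = s" "s * s = t" using unit_near_sqrt[OF assms] .
  then show "0 \<le> Re (\<omega> t)" "Im (\<omega> t) = 0" using om_st_mult_nonneg[of s] by auto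
qed

text \<open>Otherwise elements with rapidly growing values would sum to an element with arbitrarily
  large value. As continuity is not yet known, \<open>\<omega>\<close> is never exchanged with the
  series: terms are peeled off one by one, and the tails \<open>T N\<close> have nonnegative
  value.\<close>

lemma om_unit_near_bounded: "\<exists>C. \<forall>t. unit_near t \<longrightarrow> Re (\<omega> t) \<le> C"
proof (rule ccontr)
  assume "\<not> ?thesis"
  \<comment> \<open>The growth beats the weights \<open>(1/2) ^ Suc n\<close>, so that the value of
    \<open>T 0\<close> exceeds every \<open>2 ^ N\<close>.\<close>
  then have "\<forall>n. \<exists>t. unit_near t \<and> Re (\<omega> t) > 4 ^ Suc n" by (meson not_le)
  then obtain t where t: "\<And>n. unit_near (t n)" "\<And>n. Re (\<omega> (t n)) > 4 ^ Suc n" by metis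
  define T where "T N = (\<Sum>n. (1/2) ^ Suc n *\<^sub>R t (n + N))" for N
  have T0: "T N = (1/2) *\<^sub>R t N + (1/2) *\<^sub>R T (Suc N)" for N
  proof -
    have "T N = (1/2) *\<^sub>R t N + (\<Sum>n. (1/2) ^ Suc (Suc n) *\<^sub>R t (Suc n + N))"
      unfolding T_def using suminf_split_head[OF summable_unit_near[of "\<lambda>n. t (n + N)"]] t(1) by simp
    also have "(\<Sum>n. (1/2) ^ Suc (Suc n) *\<^sub>R t (Suc n + N)) = (1/2) *\<^sub>R T (Suc N)"
      unfolding T_def
      using bounded_linear.suminf[OF bounded_linear_scaleR_right summable_unit_near[of "\<lambda>n. t (n + Suc N)"], of "1/2"]
        t(1) by simp
    finally show ?thesis .
  qed
  have T_pos: "0 \<le> Re (\<omega> (T N))" for N unfolding T_def by (intro om_unit_near_nonneg unit_near_suminf t)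
  have step: "Re (\<omega> (T N)) = (Re (\<omega> (t N)) + Re (\<omega> (T (Suc N)))) / 2" for N
    by (subst T0) (simp add: om_add om_scaleR)
  have "Re (\<omega> (T 0)) \<ge> (1/2) ^ N * Re (\<omega> (T N))" for N
  proof (induction N)
    case (Suc N)
    have "(1/2) ^ Suc N * Re (\<omega> (T (Suc N))) \<le> (1/2) ^ N * Re (\<omega> (T N))"
    proof -
      have "0 \<le> Re (\<omega> (t N))" using t(2)[of N] zero_le_power[of "4::real" "Suc N"] by linarith
      then show ?thesis using step[of N] by simp
    qed
    with Suc show ?case by linarith
  qed simp
  moreover have "(1/2) ^ N * Re (\<omega> (T N)) \<ge> 2 ^ N" for N
  proof -
    have "(4::real) ^ N \<le> 4 ^ Suc N / 2" by simp
    also have "\<dots> \<le> Re (\<omega> (t N)) / 2" using t(2)[of N] by (intro divide_right_mono) auto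
    also have "\<dots> \<le> Re (\<omega> (T N))" unfolding step[of N] using T_pos[of "Suc N"] by simp
    finally have "Re (\<omega> (T N)) \<ge> 4 ^ N" .
    then have "(1/2) ^ N * Re (\<omega> (T N)) \<ge> (1/2) ^ N * 4 ^ N" by (intro mult_left_mono) auto
    then show ?thesis by (simp flip: power_mult_distrib)
  qed
  ultimately have "2 ^ N \<le> Re (\<omega> (T 0))" for N using order_trans by blast
  then show False using real_arch_pow[of 2 "Re (\<omega> (T 0))"] by (auto simp: not_le[symmetric])
qed

lemma om_selfadj_bounded: "\<exists>C\<ge>0. \<forall>x. st x = x \<longrightarrow> norm x \<le> 1 \<longrightarrow> cmod (\<omega> x) \<le> C"
proof -
  obtain C where C: "\<And>t. unit_near t \<Longrightarrow> Re (\<omega> t) \<le> C" using om_unit_near_bounded by blast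
  have "cmod (\<omega> x) \<le> 2 * \<bar>C\<bar>" if x: "st x = x" "norm x \<le> 1" for x
  proof -
    obtain p q where pq: "unit_near p" "unit_near q" "x = 2 *\<^sub>R (p - q)" using selfadj_eq_unit_near_diff[OF x] .
    have "\<omega> x = complex_of_real (2 * (Re (\<omega> p) - Re (\<omega> q)))"
      using om_unit_near_nonneg[OF pq(1)] om_unit_near_nonneg[OF pq(2)]
      by (simp add: pq(3) om_scaleR om_diff complex_eq_iff)
    moreover have "\<bar>Re (\<omega> p) - Re (\<omega> q)\<bar> \<le> \<bar>C\<bar>"
      using om_unit_near_nonneg[OF pq(1)] om_unit_near_nonneg[OF pq(2)] C[OF pq(1)] C[OF pq(2)] by linarith
    ultimately show ?thesis by (simp only: norm_of_real abs_mult) simp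
  qed
  then show ?thesis by (intro exI[of _ "2 * \<bar>C\<bar>"]) auto
qed

text \<open>Reduces estimates to selfadjoint elements; the trace enters through
  \<open>on_st\<close>, which controls the seminorms of both parts.\<close>

lemma cartesian_decomposition:
  obtains h k where "st h = h" "st k = k" "x = h + sc \<i> k" "norm h \<le> norm x" "norm k \<le> norm x"
    "on h \<le> on x" "on k \<le> on x"
proof -
  define h where "h = (1/2) *\<^sub>R (x + st x)"
  define k where "k = (1/2) *\<^sub>R sc (- \<i>) (x - st x)"
  have "sc \<i> k = (1/2) *\<^sub>R (x - st x)"
    unfolding k_def by (simp add: sc_sc flip: sc_of_real)
  then have "x = h + sc \<i> k" by (simp add: h_def scaleR_diff_right scaleR_add_right flip: scaleR_add_left)
  moreover have "st h = h" by (simp add: h_def st_scaleR st_add st_st add.commute)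
  moreover have "st k = k"
    by (simp add: k_def st_scaleR st_diff st_st st_sc sc_minus_left sc_diff_right)
  moreover have "norm h \<le> norm x" using norm_triangle_ineq[of x "st x"] by (simp add: h_def norm_st)
  moreover have "norm k \<le> norm x"
    using norm_triangle_ineq4[of x "st x"] by (simp add: k_def norm_st norm_sc)
  moreover have "on h \<le> on x" using on_triangle[of x "st x"] by (simp add: h_def on_st on_scaleR)
  moreover have "on k \<le> on x"
    using on_triangle_diff[of x "st x"] by (simp add: k_def on_st on_scaleR on_sc)
  ultimately show ?thesis using that by blast
qed

lemma om_bounded: "\<exists>C\<ge>0. \<forall>x. cmod (\<omega> x) \<le> C * norm x"
proof -
  obtain C where C: "C \<ge> 0" "\<And>x. st x = x \<Longrightarrow> norm x \<le> 1 \<Longrightarrow> cmod (\<omega> x) \<le> C"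
    using om_selfadj_bounded by blast
  have sa: "cmod (\<omega> x) \<le> C * norm x" if "st x = x" for x
  proof (cases "x = 0")
    case True
    then show ?thesis using om_scaleR[of 0 0] by simp
  next
    case False
    have "cmod (\<omega> ((1 / norm x) *\<^sub>R x)) \<le> C"
      by (rule C) (use that False in \<open>auto simp: st_scaleR\<close>)
    then show ?thesis using False by (simp add: om_scaleR norm_divide field_simps)
  qed
  have "cmod (\<omega> x) \<le> 2 * C * norm x" for x
  proof -
    obtain h k where hk: "st h = h" "st k = k" "x = h + sc \<i> k" "norm h \<le> norm x" "norm k \<le> norm x"
      using cartesian_decomposition[of x] .
    have "cmod (\<omega> x) \<le> cmod (\<omega> h) + cmod (\<omega> k)"
      unfolding hk(3) om_add om_sc using norm_triangle_ineq[of "\<omega> h" "\<i> * \<omega> k"] by (simp add: norm_mult)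
    also have "\<dots> \<le> C * norm x + C * norm x"
      by (intro add_mono order_trans[OF sa] mult_left_mono hk C(1))
    finally show ?thesis by simp
  qed
  with C(1) show ?thesis by (intro exI[of _ "2 * C"]) auto
qed

text \<open>Without a unit, continuity of \<open>\<omega>\<close> with respect to its own seminorm is obtained by splitting
  \<open>x = x\<^sup>3 + (x - x\<^sup>3)\<close>: Cauchy-Schwarz applies to the cube, and the rest has half the norm.\<close>

lemma om_selfadj_le_on:
  assumes C: "C \<ge> 0" "\<And>x. st x = x \<Longrightarrow> norm x \<le> 1 \<Longrightarrow> cmod (\<omega> x) \<le> C"
  shows "\<exists>B\<ge>0. \<forall>x. st x = x \<longrightarrow> norm x \<le> 1 \<longrightarrow> cmod (\<omega> x) \<le> B * on x + C / 2 ^ N"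
proof (induction N)
  case 0
  then show ?case using C by (intro exI[of _ 0]) simp
next
  case (Suc N)
  then obtain B where B: "B \<ge> 0"
    "\<And>x. st x = x \<Longrightarrow> norm x \<le> 1 \<Longrightarrow> cmod (\<omega> x) \<le> B * on x + C / 2 ^ N" by blast
  have "cmod (\<omega> x) \<le> (sqrt C + 2 * B) * on x + C / 2 ^ Suc N" if x: "st x = x" "norm x \<le> 1" for x
  proof -
    have xx: "norm (x * x) \<le> 1" "st (x * x) = x * x"
      using x by (auto simp: norm_sq_selfadj power_le_one st_mult)
    have on_xx: "on (x * x) \<le> on x"
      using on_mult_left[of x x] mult_right_mono[OF x(2) on_nonneg[of x]] by simp
    have "(on x)\<^sup>2 = cmod (\<omega> (x * x))" using om_st_mult_self[of x] x(1) by (simp add: norm_power)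
    then have on_x: "on x \<le> sqrt C" using C(2)[OF xx(2,1)] by (simp add: real_le_rsqrt)
    have "cmod (\<omega> (x * x * x)) \<le> on x * on (x * x)"
      using cauchy_schwarz[of x "x * x"] x(1) by (simp add: mult.assoc)
    also have "\<dots> \<le> sqrt C * on x" by (intro mult_mono on_x on_xx on_nonneg) (simp add: C)
    finally have cube: "cmod (\<omega> (x * x * x)) \<le> sqrt C * on x" .
    \<comment> \<open>The doubled remainder is again a contraction, so the induction hypothesis
      applies to it, and undoing the factor two halves the constant error.\<close>
    define z where "z = 2 *\<^sub>R (x - x * x * x)"
    have "st z = z" by (simp add: z_def st_scaleR st_diff st_mult x mult.assoc)
    moreover have "norm z \<le> 1" using norm_diff_cube[OF x] by (simp add: z_def)
    ultimately have "cmod (\<omega> z) \<le> B * on z + C / 2 ^ N" by (rule B)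
    also have "on z \<le> 4 * on x"
    proof -
      have "on (x * x * x) \<le> on x"
        using on_mult_left[of "x * x" x] mult_right_mono[OF xx(1) on_nonneg[of x]] by simp
      then show ?thesis using on_triangle_diff[of x "x * x * x"] by (simp add: z_def on_scaleR)
    qed
    finally have z: "cmod (\<omega> z) \<le> B * (4 * on x) + C / 2 ^ N" using B(1) by (simp add: mult_left_mono)
    have "\<omega> x = \<omega> (x * x * x) + \<omega> z / 2" by (simp add: z_def om_scaleR om_diff field_simps)
    then have "cmod (\<omega> x) \<le> cmod (\<omega> (x * x * x)) + cmod (\<omega> z) / 2"
      using norm_triangle_ineq[of "\<omega> (x * x * x)" "\<omega> z / 2"] by (simp add: norm_divide)
    also have "\<dots> \<le> sqrt C * on x + (B * (4 * on x) + C / 2 ^ N) / 2"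
      using cube z by (intro add_mono divide_right_mono) auto
    finally show ?thesis by (simp add: algebra_simps add_divide_distrib)
  qed
  with B(1) C(1) show ?case by (intro exI[of _ "sqrt C + 2 * B"]) auto
qed

lemma om_small_of_on_small:
  assumes e: "e > 0"
  shows "\<exists>d>0. \<forall>x. norm x \<le> R \<longrightarrow> on x < d \<longrightarrow> cmod (\<omega> x) < e"
proof -
  obtain C where C: "C \<ge> 0" "\<And>x. st x = x \<Longrightarrow> norm x \<le> 1 \<Longrightarrow> cmod (\<omega> x) \<le> C"
    using om_selfadj_bounded by blast
  define S where "S = \<bar>R\<bar> + 1"
  have S: "S > 0" "R \<le> S" by (auto simp: S_def)
  \<comment> \<open>Rescaling from radius \<open>S\<close> turns the constant error into
    \<open>C * S / 2 ^ N\<close>. \<open>N\<close> and \<open>d\<close> keep each contribution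
    within \<open>e / 4\<close>, and the two selfadjoint parts add up to less than
    \<open>e\<close>.\<close>
  obtain N where N: "C * S * 4 / e < 2 ^ N" using real_arch_pow[of 2] by auto
  obtain B where B: "B \<ge> 0"
    "\<And>x. st x = x \<Longrightarrow> norm x \<le> 1 \<Longrightarrow> cmod (\<omega> x) \<le> B * on x + C / 2 ^ N"
    using om_selfadj_le_on[OF C, of N] by blast
  define d where "d = e / (4 * (B + 1))"
  have d: "d > 0" using e B(1) by (simp add: d_def)
  have sa: "cmod (\<omega> x) < e / 2" if x: "st x = x" "norm x \<le> S" "on x < d" for x
  proof -
    have "cmod (\<omega> ((1/S) *\<^sub>R x)) \<le> B * on ((1/S) *\<^sub>R x) + C / 2 ^ N"
      by (rule B(2)) (use x S in \<open>auto simp: st_scaleR\<close>)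
    then have "cmod (\<omega> x) \<le> B * on x + C * S / 2 ^ N"
      using S by (simp add: om_scaleR on_scaleR norm_divide field_simps)
    moreover have "C * S / 2 ^ N < e / 4" using N e by (simp add: field_simps)
    moreover have "B * on x \<le> e / 4"
    proof -
      have "B * on x \<le> (B + 1) * d" using x(3) B(1) on_nonneg[of x] by (intro mult_mono) auto
      also have "\<dots> = e / 4" using B(1) by (simp add: d_def field_simps)
      finally show ?thesis .
    qed
    ultimately show ?thesis by linarith
  qed
  have "cmod (\<omega> x) < e" if x: "norm x \<le> R" "on x < d" for x
  proof -
    obtain h k where hk: "st h = h" "st k = k" "x = h + sc \<i> k" "norm h \<le> norm x" "norm k \<le> norm x"
      "on h \<le> on x" "on k \<le> on x"
      using cartesian_decomposition[of x] .
    have "cmod (\<omega> x) \<le> cmod (\<omega> h) + cmod (\<omega> k)"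
      unfolding hk(3) om_add om_sc using norm_triangle_ineq[of "\<omega> h" "\<i> * \<omega> k"] by (simp add: norm_mult)
    moreover have "cmod (\<omega> h) < e / 2" by (rule sa) (use hk(1,4,6) x S in linarith)+
    moreover have "cmod (\<omega> k) < e / 2" by (rule sa) (use hk(2,5,7) x S in linarith)+
    ultimately show ?thesis by linarith
  qed
  with d show ?thesis by blast
qed

text \<open>Supplies \<open>on a > 0\<close> from \<open>\<omega> a \<noteq> 0\<close>, a base case
  of the log-convexity argument.\<close>

lemma om_eq_0_of_on_eq_0:
  assumes "on x = 0"
  shows "\<omega> x = 0"
proof (rule ccontr)
  assume "\<omega> x \<noteq> 0"
  then obtain d where "d > 0" "\<forall>y. norm y \<le> norm x \<longrightarrow> on y < d \<longrightarrow> cmod (\<omega> y) < cmod (\<omega> x)"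
    using om_small_of_on_small[of "cmod (\<omega> x)" "norm x"] by auto
  with assms show False by auto
qed

text \<open>The powers of \<open>a = b\<^sup>* b\<close> are \<open>c\<^sub>n\<^sup>* c\<^sub>n\<close> for the alternating products
  \<open>c\<^sub>0 = b\<close>, \<open>c\<^sub>1 = b\<^sup>* b\<close>, \<open>c\<^sub>2 = b b\<^sup>* b\<close>, ..., and Cauchy-Schwarz makes \<open>\<omega> (a\<^sup>n)\<close> log-convex.\<close>

lemma om_power_pos:
  assumes a: "positive_elem st a" "Re (\<omega> a) > 0"
  shows "Re (\<omega> (ordprod (\<lambda>_. a) n)) > 0"
proof -
  obtain b where b: "a = st b * b" using a(1) by (auto simp: positive_elem_def)
  define c where "c = rec_nat b (\<lambda>n x. (if even n then st b else b) * x)"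
  have c: "c 0 = b" "\<And>n. c (Suc n) = (if even n then st b else b) * c n" by (auto simp: c_def)
  have cc: "c (Suc (Suc n)) = c n * a" for n
  proof (induction n)
    case 0
    then show ?case by (simp add: c b mult.assoc)
  next
    case (Suc n)
    then show ?case unfolding c(2)[of "Suc (Suc n)"] c(2)[of n] by (simp add: mult.assoc)
  qed
  \<comment> \<open>The leading factor of \<open>c (Suc n)\<close>, starred and moved to the right,
    is exactly the next alternating factor.\<close>
  have prod_c: "st (c (Suc n)) * c (Suc n) = st (c n) * c (Suc (Suc n))" for n
    by (auto simp: c(2) st_mult st_st mult.assoc)
  have ord: "ordprod (\<lambda>_. a) n = st (c n) * c n" for n
  proof (induction n)
    case 0
    then show ?case by (simp add: c b)
  next
    case (Suc n)
    then show ?case by (simp only: ordprod.simps prod_c) (simp add: cc mult.assoc)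
  qed
  \<comment> \<open>Log-convexity relates three consecutive indices, so positivity propagates from
    two base cases.\<close>
  have pos: "on (c n) > 0" for n
  proof (induction n rule: induct_nat_012)
    case 0
    then show ?case using a(2) by (simp add: c b omega_norm_def)
  next
    case 1
    have "c 1 = a" by (simp add: c b)
    then show ?case using om_eq_0_of_on_eq_0[of a] a(2) on_nonneg[of a] by (auto simp: less_le)
  next
    case (ge2 n)
    have "(on (c (Suc n)))\<^sup>2 = cmod (\<omega> (st (c n) * c (Suc (Suc n))))"
      using om_st_mult_self[of "c (Suc n)"] by (simp add: prod_c norm_power)
    also have "\<dots> \<le> on (c n) * on (c (Suc (Suc n)))" by (rule cauchy_schwarz)
    finally have "on (c (Suc (Suc n))) \<noteq> 0" using ge2(2) by auto
    then show ?case using on_nonneg[of "c (Suc (Suc n))"] by simp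
  qed
  show ?thesis unfolding ord om_st_mult_self using pos[of n] by simp
qed

section \<open>Ordered products close to a power of \<open>a\<close>\<close>

lemma norm_ordprod_le:
  assumes "\<And>j. j \<le> k \<Longrightarrow> norm (b j :: 'a) \<le> R" "0 \<le> R"
  shows "norm (ordprod b k) \<le> R ^ Suc k"
  using assms(1)
proof (induction k)
  case (Suc k)
  have "norm (ordprod b k * b (Suc k)) \<le> norm (ordprod b k) * norm (b (Suc k))"
    by (rule norm_mult_ineq)
  also have "\<dots> \<le> R ^ Suc k * R" using Suc assms(2) by (intro mult_mono) auto
  finally show ?case by (simp add: mult.commute)
qed simp

text \<open>Factors are replaced one at a time: the product to the left is absorbed by
  \<open>on_mult_left\<close>, the factor \<open>a\<close> on the right by
  \<open>on_mult_right\<close>, which rests on the trace.\<close>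

lemma on_ordprod_diff_le:
  assumes "\<And>j. j \<le> k \<Longrightarrow> norm (b j) \<le> norm a" "\<And>j. j \<le> k \<Longrightarrow> on (b j - a) \<le> e"
  shows "on (ordprod b k - ordprod (\<lambda>_. a) k) \<le> real (Suc k) * norm a ^ k * e"
  using assms
proof (induction k)
  case (Suc k)
  let ?A = "ordprod (\<lambda>_. a) k" and ?B = "ordprod b k"
  have IH: "on (?B - ?A) \<le> real (Suc k) * norm a ^ k * e" using Suc by simp
  have "ordprod b (Suc k) - ordprod (\<lambda>_. a) (Suc k) = ?B * (b (Suc k) - a) + (?B - ?A) * a"
    by (simp add: algebra_simps)
  then have "on (ordprod b (Suc k) - ordprod (\<lambda>_. a) (Suc k))
      \<le> on (?B * (b (Suc k) - a)) + on ((?B - ?A) * a)"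
    using on_triangle by metis
  also have "\<dots> \<le> norm ?B * on (b (Suc k) - a) + on (?B - ?A) * norm a"
    by (intro add_mono on_mult_left on_mult_right)
  also have "\<dots> \<le> norm a ^ Suc k * e + real (Suc k) * norm a ^ k * e * norm a"
    using Suc.prems by (intro add_mono mult_mono[OF norm_ordprod_le] mult_right_mono[OF IH] on_nonneg) auto
  finally show ?case by (simp add: algebra_simps)
qed simp

lemma om_ordprod_lower_bound:
  assumes "positive_elem st a" "Re (\<omega> a) > 0"
  obtains e c where "e > 0" "c > 0"
    "\<And>b. (\<And>j. j \<le> k \<Longrightarrow> norm (b j) \<le> norm a) \<Longrightarrow> (\<And>j. j \<le> k \<Longrightarrow> on (b j - a) < e) \<Longrightarrow>
      c \<le> cmod (\<omega> (ordprod b k))"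
proof -
  define p where "p = Re (\<omega> (ordprod (\<lambda>_. a) k))"
  have p: "p > 0" unfolding p_def by (rule om_power_pos[OF assms])
  \<comment> \<open>\<open>2 * norm a ^ Suc k\<close> bounds the norm of the difference of the two
    products, each having \<open>Suc k\<close> factors.\<close>
  obtain d where d: "d > 0"
    "\<And>x. norm x \<le> 2 * norm a ^ Suc k \<Longrightarrow> on x < d \<Longrightarrow> cmod (\<omega> x) < p / 2"
    using om_small_of_on_small[of "p / 2" "2 * norm a ^ Suc k"] p by auto
  define D where "D = real (Suc k) * norm a ^ k + 1"
  have D: "D > 0" by (simp add: D_def add_nonneg_pos)
  show ?thesis
  proof (rule that[of "d / D" "p / 2"])
    fix b assume b: "\<And>j. j \<le> k \<Longrightarrow> norm (b j) \<le> norm a" "\<And>j. j \<le> k \<Longrightarrow> on (b j - a) < d / D"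
    let ?x = "ordprod b k - ordprod (\<lambda>_. a) k"
    have "on ?x \<le> real (Suc k) * norm a ^ k * (d / D)"
      by (rule on_ordprod_diff_le) (use b in \<open>auto intro: less_imp_le\<close>)
    also have "\<dots> < D * (d / D)" using d D by (intro mult_strict_right_mono) (auto simp: D_def)
    finally have "on ?x < d" using D by simp
    moreover have "norm ?x \<le> norm a ^ Suc k + norm a ^ Suc k"
      by (intro order_trans[OF norm_triangle_ineq4] add_mono norm_ordprod_le) (use b in auto)
    ultimately have "cmod (\<omega> ?x) < p / 2" using d(2) by simp
    moreover have "p \<le> cmod (\<omega> (ordprod (\<lambda>_. a) k))" unfolding p_def by (rule complex_Re_le_cmod)
    moreover have "cmod (\<omega> (ordprod (\<lambda>_. a) k)) \<le> cmod (\<omega> (ordprod b k)) + cmod (\<omega> ?x)"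
      unfolding om_diff by (metis norm_minus_commute norm_triangle_sub)
    ultimately show "p / 2 \<le> cmod (\<omega> (ordprod b k))" by linarith
  qed (use p d D in auto)
qed

end

section \<open>Return times in compact systems\<close>

lemma gpow_0: "gpow 0 g = 0"
  by (simp add: gpow_def)

lemma gpow_Suc: "gpow (Suc m) g = g + gpow m g"
  by (simp add: gpow_def)

text \<open>Commutativity of the group enters here; it makes \<open>tau_pow\<close> compatible with
  sums at every exponent.\<close>

lemma gpow_add: "gpow m (g + h) = gpow m g + gpow m h"
  by (induction m) (simp_all add: gpow_0 gpow_Suc algebra_simps)

text \<open>The neutral element may lie outside \<open>K\<close>, so exponent zero is excluded;
  \<open>tau_pow\<close> treats it separately.\<close>

lemma gpow_mem:
  assumes "semigroup_set K" "g \<in> K" "m \<noteq> 0"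
  shows "gpow m g \<in> K"
proof -
  have "gpow (Suc m) g \<in> K" for m
  proof (induction m)
    case (Suc m)
    then show ?case using assms unfolding gpow_Suc[of "Suc m"] by (simp add: semigroup_set_def)
  qed (use assms in \<open>simp add: gpow_Suc gpow_0\<close>)
  then show ?thesis using assms(3) by (metis not0_implies_Suc)
qed

locale compact_trace_system = cstar_trace sc st \<omega>
  for sc :: "complex \<Rightarrow> 'a::{real_normed_algebra, banach} \<Rightarrow> 'a" and st :: "'a \<Rightarrow> 'a"
    and \<omega> :: "'a \<Rightarrow> complex" +
  fixes \<tau> :: "'g::ab_group_add \<Rightarrow> 'a \<Rightarrow> 'a" and K :: "'g set"
  assumes compact_cstar_system: "compact_cstar_system sc st \<omega> \<tau> K"
begin

lemma
  shows semigroup_K: "semigroup_set K"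
    and tau_add: "g \<in> K \<Longrightarrow> \<tau> g (x + y) = \<tau> g x + \<tau> g y"
    and tau_sc: "g \<in> K \<Longrightarrow> \<tau> g (sc c x) = sc c (\<tau> g x)"
    and tau_tau: "g \<in> K \<Longrightarrow> h \<in> K \<Longrightarrow> \<tau> g (\<tau> h x) = \<tau> (g + h) x"
    and on_tau: "g \<in> K \<Longrightarrow> on (\<tau> g x) = on x"
    and norm_tau_le: "g \<in> K \<Longrightarrow> norm (\<tau> g x) \<le> norm x"
    and totally_bounded_orbit: "totally_bounded_sn on {\<tau> g x | g. g \<in> K}"
  using compact_cstar_system unfolding compact_cstar_system_def clinear_on_def
  by (auto simp: fun_eq_iff)

lemma tau_diff: "g \<in> K \<Longrightarrow> \<tau> g (x - y) = \<tau> g x - \<tau> g y"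
  using tau_add[of g x "sc (-1) y"] tau_sc[of g "-1" y] by (simp add: sc_minus_one)

lemma norm_tau_pow_le: "g \<in> K \<Longrightarrow> norm (tau_pow \<tau> g m x) \<le> norm x"
  using norm_tau_le gpow_mem[OF semigroup_K] by (simp add: tau_pow_def)

lemma on_tau_pow: "g \<in> K \<Longrightarrow> on (tau_pow \<tau> g m x) = on x"
  using on_tau gpow_mem[OF semigroup_K] by (simp add: tau_pow_def)

lemma tau_pow_diff: "g \<in> K \<Longrightarrow> tau_pow \<tau> g m (x - y) = tau_pow \<tau> g m x - tau_pow \<tau> g m y"
  using tau_diff gpow_mem[OF semigroup_K] by (simp add: tau_pow_def)

lemma tau_pow_add:
  "g \<in> K \<Longrightarrow> h \<in> K \<Longrightarrow> tau_pow \<tau> (g + h) m x = tau_pow \<tau> g m (tau_pow \<tau> h m x)"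
  using tau_tau gpow_mem[OF semigroup_K] by (simp add: tau_pow_def gpow_add)

text \<open>A separated subset of \<open>K\<close> of maximal cardinality stays one after translation by \<open>q + g\<close>, so
  some translated point comes close to the orbit point of \<open>q\<close>; the isometry then cancels \<open>q\<close>.\<close>

lemma return_times_syndetic:
  fixes m :: "nat \<Rightarrow> nat" and k :: nat
  assumes K: "K \<noteq> {}" and e: "e > 0"
  obtains H where "finite H" "H \<subseteq> K"
    "\<And>g. g \<in> K \<Longrightarrow> \<exists>h\<in>H. \<forall>j\<le>k. on (tau_pow \<tau> (g + h) (m j) a - a) < e"
proof -
  define tp where "tp g j = tau_pow \<tau> g (m j) a" for g j
  define sep where "sep S \<longleftrightarrow> finite S \<and> S \<subseteq> K \<and>
    (\<forall>x\<in>S. \<forall>y\<in>S. x \<noteq> y \<longrightarrow> (\<exists>j\<le>k. on (tp x j - tp y j) \<ge> e))" for S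
  obtain F0 where F0: "finite F0" "\<And>x. x \<in> {\<tau> g a | g. g \<in> K} \<Longrightarrow> \<exists>y\<in>F0. on (x - y) < e / 2"
    using totally_bounded_orbit[of a] e unfolding totally_bounded_sn_def by (meson half_gt_zero)
  have on_0: "on 0 = 0" using on_scaleR[of 0 0] by simp
  \<comment> \<open>Exponent zero contributes the point \<open>a\<close>, which need not lie on the
    orbit and is therefore added to the net.\<close>
  have "\<exists>y\<in>insert a F0. on (tp g j - y) < e / 2" if "g \<in> K" for g j
  proof (cases "m j = 0")
    case True
    then show ?thesis using e on_0 by (simp add: tp_def tau_pow_def)
  next
    case False
    then have "tp g j \<in> {\<tau> g a | g. g \<in> K}"
      using gpow_mem[OF semigroup_K that] by (auto simp: tp_def tau_pow_def)
    then show ?thesis using F0(2) by blast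
  qed
  then obtain f where f: "\<And>g j. g \<in> K \<Longrightarrow> f g j \<in> insert a F0 \<and> on (tp g j - f g j) < e / 2"
    by metis
  \<comment> \<open>Each point of \<open>K\<close> is coded by net points near its
    \<open>k + 1\<close> orbit points. Separated points have different codes, so the number of codes
    bounds the size of separated sets.\<close>
  let ?P = "PiE {..k} (\<lambda>_. insert a F0)"
  have fin: "finite ?P" using F0(1) by (intro finite_PiE) auto
  have card_le: "card S \<le> card ?P" if S: "sep S" for S
  proof (rule card_inj_on_le[OF _ _ fin])
    show "inj_on (\<lambda>g. restrict (f g) {..k}) S"
    proof (rule inj_onI, rule ccontr)
      fix x y assume xy: "x \<in> S" "y \<in> S" "restrict (f x) {..k} = restrict (f y) {..k}" "x \<noteq> y"
      then obtain j where j: "j \<le> k" "on (tp x j - tp y j) \<ge> e" using S unfolding sep_def by blast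
      have eq: "f x j = f y j" using xy(3) j(1) by (metis atMost_iff restrict_apply')
      have "x \<in> K" "y \<in> K" using xy S by (auto simp: sep_def)
      then have "on (tp x j - f x j) < e / 2" "on (tp y j - f x j) < e / 2"
        using f eq by metis+
      then show False
        using on_triangle_diff[of "tp x j - f x j" "tp y j - f x j"] j(2) by simp
    qed
    show "(\<lambda>g. restrict (f g) {..k}) ` S \<subseteq> ?P"
    proof (rule image_subsetI)
      fix g assume "g \<in> S"
      then have "g \<in> K" using S by (auto simp: sep_def)
      then show "restrict (f g) {..k} \<in> ?P" using f by (simp add: restrict_PiE_iff)
    qed
  qed
  have "sep {}" by (simp add: sep_def)
  then obtain H where H: "sep H" "\<And>S. sep S \<Longrightarrow> card S \<le> card H"
    using ex_has_greatest_nat[of sep "{}" card "Suc (card ?P)"] card_le by (auto simp: less_Suc_eq_le)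
  have "\<exists>h\<in>H. \<forall>j\<le>k. on (tp (g + h) j - a) < e" if g: "g \<in> K" for g
  proof (rule ccontr)
    assume "\<not> ?thesis"
    then have far: "\<And>h. h \<in> H \<Longrightarrow> \<exists>j\<le>k. on (tp (g + h) j - a) \<ge> e" by (auto simp: not_less)
    \<comment> \<open>\<open>q\<close> stands in for the neutral element: as it acts isometrically,
      the distance from the orbit point of \<open>q + (g + h)\<close> to that of \<open>q\<close> is
      the distance from the orbit point of \<open>g + h\<close> to \<open>a\<close>.\<close>
    obtain q where q: "q \<in> K" using K by blast
    have HK: "finite H" "H \<subseteq> K" using H(1) by (auto simp: sep_def)
    have qg: "q + g \<in> K" using q g semigroup_K by (simp add: semigroup_set_def)
    have gh: "g + h \<in> K" if "h \<in> H" for h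
      using g that HK semigroup_K by (auto simp: semigroup_set_def)
    \<comment> \<open>If no \<open>h\<close> works for \<open>g\<close>, this translate is
      separated, as large as \<open>H\<close> and far from \<open>q\<close>, so adding
      \<open>q\<close> contradicts maximality.\<close>
    define H' where "H' = (\<lambda>h. q + g + h) ` H"
    have far_q: "\<exists>j\<le>k. on (tp x j - tp q j) \<ge> e" if x: "x \<in> H'" for x
    proof -
      obtain h where h: "h \<in> H" "x = q + (g + h)" using x by (auto simp: H'_def add.assoc)
      have "tp x j - tp q j = tau_pow \<tau> q (m j) (tp (g + h) j - a)" for j
        by (simp add: tp_def h(2) tau_pow_add tau_pow_diff q gh[OF h(1)])
      then show ?thesis using far[OF h(1)] on_tau_pow[OF q] by simp
    qed
    have sep_H': "\<exists>j\<le>k. on (tp x j - tp y j) \<ge> e" if xy: "x \<in> H'" "y \<in> H'" "x \<noteq> y" for x y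
    proof -
      obtain h i where hi: "h \<in> H" "i \<in> H" "x = q + g + h" "y = q + g + i"
        using xy(1,2) unfolding H'_def by blast
      then have "h \<noteq> i" using xy(3) by auto
      then obtain j where j: "j \<le> k" "on (tp h j - tp i j) \<ge> e"
        using H(1) hi(1,2) unfolding sep_def by metis
      have K': "h \<in> K" "i \<in> K" using hi HK by auto
      have "tp x j - tp y j = tau_pow \<tau> (q + g) (m j) (tp h j - tp i j)"
        by (simp add: tp_def hi tau_pow_add tau_pow_diff qg K')
      then show ?thesis using j on_tau_pow[OF qg] by metis
    qed
    have "q \<notin> H'" using far_q[of q] e on_0 by auto
    moreover have "card H' = card H" unfolding H'_def by (rule card_image) (auto simp: inj_on_def)
    moreover have "finite H'" using HK by (simp add: H'_def)
    ultimately have "card (insert q H') = Suc (card H)" by simp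
    moreover have "sep (insert q H')"
    proof -
      have "H' \<subseteq> K" using gh q semigroup_K by (auto simp: H'_def semigroup_set_def add.assoc)
      moreover have "\<exists>j\<le>k. on (tp x j - tp y j) \<ge> e"
        if "x \<in> insert q H'" "y \<in> insert q H'" "x \<noteq> y" for x y
      proof -
        from that consider "x \<in> H'" "y \<in> H'" | "x \<in> H'" "y = q" | "y \<in> H'" "x = q" by auto
        then show ?thesis
        proof cases
          case 1
          then show ?thesis using sep_H' that(3) by metis
        next
          case 2
          then show ?thesis using far_q by metis
        next
          case 3
          then show ?thesis using far_q[of y] by (simp add: on_minus_commute)
        qed
      qed
      ultimately show ?thesis unfolding sep_def using \<open>finite H'\<close> q by auto
    qed
    ultimately show False using H(2) by fastforce
  qed
  then show ?thesis using H(1) by (intro that[of H]) (auto simp: sep_def tp_def)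
qed

end

section \<open>Translates of Folner sequences\<close>

lemma
  fixes M :: "'g::{topological_ab_group_add, t2_space} measure"
  assumes M: "haar_measure M"
  shows sets_haar: "sets M = sets borel"
    and measure_haar_translate: "A \<in> sets borel \<Longrightarrow> measure M ((\<lambda>x. x + g) ` A) = measure M A"
    and emeasure_haar_compact: "compact C \<Longrightarrow> emeasure M C < \<infinity>"
  using M by (auto simp: haar_measure_def measure_def)

lemma compact_translate:
  fixes A :: "'g::topological_ab_group_add set"
  shows "compact A \<Longrightarrow> compact ((\<lambda>x. x + g) ` A)"
  by (rule compact_continuous_image) (auto intro!: continuous_intros)

text \<open>Translations commute, so the symmetric difference for a translate is a translate of the
  original one and all measures agree; the shift may vary arbitrarily with \<open>n\<close>.\<close>

lemma folner_translate:
  fixes M :: "'g::{topological_ab_group_add, t2_space} measure"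
  assumes M: "haar_measure M" and L: "folner M L"
  shows "folner M (\<lambda>n. (\<lambda>x. x + h n) ` L n)"
proof -
  have cpt: "compact (L n)" for n using L by (simp add: folner_def)
  have bor: "A \<in> sets borel" if "compact A" for A :: "'g set"
    using that by (simp add: compact_imp_closed borel_closed)
  have meas: "measure M ((\<lambda>x. x + h n) ` L n) = measure M (L n)" for n
    by (rule measure_haar_translate[OF M bor[OF cpt]])
  define D where "D A g = (A - (\<lambda>x. x + g) ` A) \<union> ((\<lambda>x. x + g) ` A - A)" for A :: "'g set" and g
  have "D ((\<lambda>x. x + h n) ` L n) g = (\<lambda>x. x + h n) ` D (L n) g" for n g
  proof -
    have inj: "inj (\<lambda>x. x + h n)" by (simp add: inj_on_def)
    have "(\<lambda>x. x + g) ` (\<lambda>x. x + h n) ` L n = (\<lambda>x. x + h n) ` (\<lambda>x. x + g) ` L n"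
      by (simp add: image_image ac_simps)
    then show ?thesis unfolding D_def image_Un image_set_diff[OF inj] by simp
  qed
  moreover have "D (L n) g \<in> sets borel" for n g
    unfolding D_def by (intro sets.Un sets.Diff bor cpt compact_translate)
  ultimately have "measure M (D ((\<lambda>x. x + h n) ` L n) g) = measure M (D (L n) g)" for n g
    using measure_haar_translate[OF M] by simp
  then show ?thesis
    using L compact_translate[OF cpt] unfolding folner_def D_def[symmetric] meas by simp
qed

text \<open>Pigeonhole: the pieces \<open>{x \<in> C. x + h \<in> E}\<close> cover \<open>C\<close>,
  so one has at least the average share, and translating it by \<open>h\<close> lands in
  \<open>E\<close>.\<close>

lemma exists_translate_dense:
  fixes M :: "'g::{topological_ab_group_add, t2_space} measure"
  assumes M: "haar_measure M" and C: "compact C" and E: "E \<in> sets borel" and H: "finite H" "H \<noteq> {}"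
    and cover: "\<And>g. g \<in> C \<Longrightarrow> \<exists>h\<in>H. g + h \<in> E"
  shows "\<exists>h\<in>H. measure M C / real (card H) \<le> measure M ((\<lambda>x. x + h) ` C \<inter> E)"
proof (rule ccontr)
  assume "\<not> ?thesis"
  then have lt: "\<And>h. h \<in> H \<Longrightarrow> measure M ((\<lambda>x. x + h) ` C \<inter> E) < measure M C / real (card H)"
    by (auto simp: not_le)
  define F where "F h = {x \<in> C. x + h \<in> E}" for h
  have C_borel: "C \<in> sets borel" using C by (simp add: compact_imp_closed borel_closed)
  have F: "F h \<in> sets borel" for h
  proof -
    have "(\<lambda>x. x + h) \<in> borel_measurable borel"
      by (intro borel_measurable_continuous_onI continuous_intros)
    from measurable_sets[OF this E] have "(\<lambda>x. x + h) -` E \<in> sets borel" by simp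
    then have "C \<inter> (\<lambda>x. x + h) -` E \<in> sets borel" using C_borel by blast
    moreover have "F h = C \<inter> (\<lambda>x. x + h) -` E" by (auto simp: F_def)
    ultimately show ?thesis by simp
  qed
  have "measure M (F h) = measure M ((\<lambda>x. x + h) ` C \<inter> E)" for h
  proof -
    have "(\<lambda>x. x + h) ` F h = (\<lambda>x. x + h) ` C \<inter> E" by (auto simp: F_def)
    then show ?thesis using measure_haar_translate[OF M F] by metis
  qed
  moreover have "C = (\<Union>h\<in>H. F h)" using cover by (auto simp: F_def)
  ultimately have "measure M C \<le> (\<Sum>h\<in>H. measure M ((\<lambda>x. x + h) ` C \<inter> E))"
    using measure_UNION_le[OF H(1), of F M] F sets_haar[OF M] by simp
  also have "\<dots> < (\<Sum>h\<in>H. measure M C / real (card H))"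
    by (rule sum_strict_mono[OF H lt])
  also have "\<dots> = measure M C" using H by simp
  finally show False by simp
qed

section \<open>Averages over translates rich in return times\<close>

theorem theorem5p13:
  fixes M :: "'g::{topological_ab_group_add, second_countable_topology, t2_space} measure"
    and L :: "nat \<Rightarrow> 'g set" and K :: "'g set"
    and sc :: "complex \<Rightarrow> 'a::{real_normed_algebra, banach} \<Rightarrow> 'a" and st :: "'a \<Rightarrow> 'a"
    and \<omega> :: "'a \<Rightarrow> complex" and \<tau> :: "'g \<Rightarrow> 'a \<Rightarrow> 'a"
    and a :: 'a and m :: "nat \<Rightarrow> nat" and k :: nat
  assumes "lcsc_abelian_group TYPE('g)"
    and "haar_measure M"
    and "folner M L"
    and "K \<in> sets borel" and "semigroup_set K"
    and "\<And>n. L n \<subseteq> K"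
    and "compact_cstar_system sc st \<omega> \<tau> K"
    and "is_trace sc st \<omega>"
    and "positive_elem st a" and "Re (\<omega> a) > 0"
    and "(\<lambda>g. \<omega> (ordprod (\<lambda>j. tau_pow \<tau> g (m j) a) k)) \<in> borel_measurable (restrict_space borel K)"
    and "\<And>j. j \<le> k \<Longrightarrow>
           (\<lambda>g. omega_norm st \<omega> (tau_pow \<tau> g (m j) a - a)) \<in> borel_measurable (restrict_space borel K)"
  shows "\<exists>L'. folner M L' \<and> (\<forall>n. L' n \<subseteq> K) \<and>
           liminf (\<lambda>n. ereal (1 / measure M (L' n) *
              (\<integral>g\<in>L' n. cmod (\<omega> (ordprod (\<lambda>j. tau_pow \<tau> g (m j) a) k)) \<partial>M))) > 0"
proof -
  note M = \<open>haar_measure M\<close> and L = \<open>folner M L\<close> and KB = \<open>K \<in> sets borel\<close>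
    and SK = \<open>semigroup_set K\<close> and LK = \<open>\<And>n. L n \<subseteq> K\<close>
  interpret compact_trace_system sc st \<omega> \<tau> K
    using assms by unfold_locales
      (auto simp: compact_cstar_system_def is_trace_def)
  let ?p = "\<lambda>g. ordprod (\<lambda>j. tau_pow \<tau> g (m j) a) k"
  have cpt: "compact (L n)" and pos: "measure M (L n) > 0" for n using L by (auto simp: folner_def)
  have "L 0 \<noteq> {}" using pos[of 0] by auto
  then have K: "K \<noteq> {}" using LK by blast
  obtain e c where e: "e > 0" and c: "c > 0" and lower:
    "\<And>b. (\<And>j. j \<le> k \<Longrightarrow> norm (b j) \<le> norm a) \<Longrightarrow> (\<And>j. j \<le> k \<Longrightarrow> on (b j - a) < e) \<Longrightarrow>
      c \<le> cmod (\<omega> (ordprod b k))"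
    using om_ordprod_lower_bound[OF \<open>positive_elem st a\<close> \<open>Re (\<omega> a) > 0\<close>, of k] by metis
  obtain H where H: "finite H" "H \<subseteq> K"
    and return: "\<And>g. g \<in> K \<Longrightarrow> \<exists>h\<in>H. \<forall>j\<le>k. on (tau_pow \<tau> (g + h) (m j) a - a) < e"
    using return_times_syndetic[OF K e, of k m a] by metis
  have H_ne: "H \<noteq> {}" using K return by blast
  define E where "E = {g \<in> K. \<forall>j\<le>k. on (tau_pow \<tau> g (m j) a - a) < e}"
  \<comment> \<open>The displacements are measurable on \<open>K\<close> only; as \<open>K\<close>
    is Borel, so is \<open>E\<close>.\<close>
  have E: "E \<in> sets borel"
  proof -
    let ?R = "restrict_space borel K"
    have "{g \<in> space ?R. \<forall>j\<in>{..k}. on (tau_pow \<tau> g (m j) a - a) < e} \<in> sets ?R"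
    proof (rule sets.sets_Collect_finite_All)
      fix j assume "j \<in> {..k}"
      then have [measurable]: "(\<lambda>g. on (tau_pow \<tau> g (m j) a - a)) \<in> borel_measurable ?R"
        using assms(12) by simp
      show "{g \<in> space ?R. on (tau_pow \<tau> g (m j) a - a) < e} \<in> sets ?R" by measurable
    qed simp
    moreover have "{g \<in> space ?R. \<forall>j\<in>{..k}. on (tau_pow \<tau> g (m j) a - a) < e} = E"
      by (auto simp: E_def space_restrict_space)
    ultimately show ?thesis using KB by (simp add: sets_restrict_space_iff)
  qed
  have "\<exists>h\<in>H. measure M (L n) / real (card H) \<le> measure M ((\<lambda>x. x + h) ` L n \<inter> E)" for n
  proof (rule exists_translate_dense[OF M cpt E H(1) H_ne])
    fix g assume "g \<in> L n"
    then have g: "g \<in> K" using LK by blast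
    then obtain h where h: "h \<in> H" "\<forall>j\<le>k. on (tau_pow \<tau> (g + h) (m j) a - a) < e"
      using return by blast
    moreover have "g + h \<in> K" using g h H SK by (auto simp: semigroup_set_def)
    ultimately show "\<exists>h\<in>H. g + h \<in> E" by (auto simp: E_def)
  qed
  then obtain h where h: "\<And>n. h n \<in> H"
    "\<And>n. measure M (L n) / real (card H) \<le> measure M ((\<lambda>x. x + h n) ` L n \<inter> E)" by metis
  define L' where "L' n = (\<lambda>x. x + h n) ` L n" for n
  have fol: "folner M L'" unfolding L'_def by (rule folner_translate[OF M L])
  have L'K: "L' n \<subseteq> K" for n using LK[of n] h(1)[of n] H SK by (auto simp: L'_def semigroup_set_def)
  have L'_cpt: "compact (L' n)" for n using fol by (simp add: folner_def)
  then have L'_borel: "L' n \<in> sets borel" for n by (simp add: compact_imp_closed borel_closed)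
  have L'_meas: "measure M (L' n) = measure M (L n)" for n
    unfolding L'_def using cpt[of n]
    by (intro measure_haar_translate[OF M]) (simp add: compact_imp_closed borel_closed)
  \<comment> \<open>This bound gives integrability over \<open>L' n\<close>, which the lower
    estimate requires: the Bochner integral of a non-integrable function is zero by
    convention.\<close>
  obtain B where B: "B \<ge> 0" "\<And>x. cmod (\<omega> x) \<le> B * norm x" using om_bounded by blast
  have upper: "cmod (\<omega> (?p g)) \<le> B * norm a ^ Suc k" if "g \<in> K" for g
    by (intro order_trans[OF B(2)] mult_left_mono norm_ordprod_le norm_tau_pow_le that B(1)) simp
  have avg: "c / real (card H) \<le> 1 / measure M (L' n) * (\<integral>g\<in>L' n. cmod (\<omega> (?p g)) \<partial>M)" for n
  proof -
    let ?f = "\<lambda>g. indicator (L' n) g *\<^sub>R cmod (\<omega> (?p g))"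
    have fin: "emeasure M A < \<infinity>" if "A \<subseteq> L' n" for A
      using that emeasure_haar_compact[OF M L'_cpt, of n] emeasure_mono[of A "L' n" M]
        L'_borel[of n] sets_haar[OF M] by (simp add: order_le_less_trans)
    have sets: "L' n \<in> sets M" "L' n \<inter> E \<in> sets M" using L'_borel[of n] E sets_haar[OF M] by auto
    have "(\<lambda>g. cmod (\<omega> (?p g))) \<in> borel_measurable (restrict_space borel K)"
      by (rule measurable_compose[OF assms(11) borel_measurable_norm])
    \<comment> \<open>Extension by zero outside \<open>K\<close>, followed by a cut to
      \<open>L' n\<close>, a subset of \<open>K\<close>, gives measurability on the whole
      group.\<close>
    then have "(\<lambda>g. indicator K g *\<^sub>R cmod (\<omega> (?p g))) \<in> borel_measurable M"
      using KB sets_haar[OF M] by (simp add: borel_measurable_restrict_space_iff cong: measurable_cong_sets)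
    moreover have "indicator (L' n) \<in> borel_measurable M" using sets(1) by (rule borel_measurable_indicator)
    ultimately have "(\<lambda>g. indicator (L' n) g * (indicator K g *\<^sub>R cmod (\<omega> (?p g)))) \<in> borel_measurable M"
      by (intro borel_measurable_times)
    moreover have "(\<lambda>g. indicator (L' n) g * (indicator K g *\<^sub>R cmod (\<omega> (?p g)))) = ?f"
      using L'K[of n] by (auto simp: fun_eq_iff indicator_def)
    ultimately have f_meas: "?f \<in> borel_measurable M" by simp
    have f_int: "integrable M ?f"
    proof (rule Bochner_Integration.integrable_bound[OF _ f_meas])
      show "integrable M (\<lambda>g. (B * norm a ^ Suc k) * indicator (L' n) g)"
        using sets(1) fin[of "L' n"] by (intro integrable_mult_right integrable_real_indicator) auto
      show "AE g in M. norm (?f g) \<le> norm ((B * norm a ^ Suc k) * indicator (L' n) g)"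
        using upper L'K[of n] B(1) by (auto simp: indicator_def)
    qed
    \<comment> \<open>The integrand is at least \<open>c\<close> on \<open>L' n \<inter> E\<close>,
      which carries at least the share \<open>1 / card H\<close> of \<open>L' n\<close>.\<close>
    have "c * measure M (L' n \<inter> E) = (\<integral>g. c * indicator (L' n \<inter> E) g \<partial>M)"
      using sets(2) fin[of "L' n \<inter> E"] by simp
    also have "\<dots> \<le> (\<integral>g. ?f g \<partial>M)"
    proof (rule integral_mono[OF _ f_int])
      show "integrable M (\<lambda>g. c * indicator (L' n \<inter> E) g)"
        using sets(2) fin[of "L' n \<inter> E"] by (intro integrable_mult_right integrable_real_indicator) auto
      fix g
      have "c \<le> cmod (\<omega> (?p g))" if "g \<in> E"
        using that by (intro lower norm_tau_pow_le) (auto simp: E_def)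
      then show "c * indicator (L' n \<inter> E) g \<le> ?f g" by (auto simp: indicator_def)
    qed
    also have "\<dots> = (\<integral>g\<in>L' n. cmod (\<omega> (?p g)) \<partial>M)" by (simp add: set_lebesgue_integral_def)
    finally have "c * measure M (L' n \<inter> E) \<le> (\<integral>g\<in>L' n. cmod (\<omega> (?p g)) \<partial>M)" .
    moreover have "c * (measure M (L' n) / real (card H)) \<le> c * measure M (L' n \<inter> E)"
      using h(2)[of n] c unfolding L'_meas unfolding L'_def by (intro mult_left_mono) auto
    ultimately have "c * (measure M (L' n) / real (card H)) \<le> (\<integral>g\<in>L' n. cmod (\<omega> (?p g)) \<partial>M)"
      by linarith
    then show ?thesis using pos[of n] L'_meas[of n] by (simp add: field_simps)
  qed
  have "0 < ereal (c / real (card H))" using c H(1) H_ne by (simp add: card_gt_0_iff)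
  also have "\<dots> \<le> liminf (\<lambda>n. ereal (1 / measure M (L' n) * (\<integral>g\<in>L' n. cmod (\<omega> (?p g)) \<partial>M)))"
    by (intro Liminf_bounded always_eventually allI) (simp only: ereal_less_eq avg)
  finally show ?thesis using fol L'K by blast
qed

end
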